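(* Let $(\varphi_t)_{t\ge0}$ be a non-elliptic semigroup in $\mathbb{D}$ with Denjoy–Wolff point $\tau\in\partial\mathbb{D}$, Koenigs function $h$, and planar domain $\Omega:=h(\mathbb{D})$. Fix some $p\in\mathsf{NP}(\Omega)$. Suppose that $$\liminf_{t\to+\infty}\frac{\alpha^-_{\Omega,p}(t/2)}{\alpha^-_{\Omega,p}(t)}>0\quad\text{and}\quad \liminf_{t\to+\infty}\frac{\alpha^+_{\Omega,p}(t/2)}{\alpha^+_{\Omega,p}(t)}>0.$$ Then the following are equivalent: (i) The trajectory $t\mapsto\varphi_t(z)$ converges non-tangentially to $\tau$ as $t\to+\infty$ for some (and hence all) $z\in\mathbb{D}$. (ii) There exist $T>0$ and $0<C_1<C_2$ such that for all $t>T$, $$C_1\,\alpha^+_{\Omega,p}(t)\le\alpha^-_{\Omega,p}(t)\le C_2\,\alpha^+_{\Omega,p}(t).$$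
   Context: $\mathbb{D}$ is the open unit disk in $\mathbb{C}$. A semigroup in $\mathbb{D}$ is a family $(\varphi_t)_{t\ge0}$ of holomorphic maps $\varphi_t:\mathbb{D}\to\mathbb{D}$ with $\varphi_0=\mathrm{id}$, $\varphi_{s+t}=\varphi_s\circ\varphi_t$ for all $s,t\ge0$, and $t\mapsto\varphi_t$ continuous for the topology of uniform convergence on compacta. It is non-elliptic if no $\varphi_t$ with $t>0$ has a fixed point in $\mathbb{D}$; then there is a unique $\tau\in\partial\mathbb{D}$, the Denjoy–Wolff point (DW-point), with $\varphi_t(z)\to\tau$ as $t\to+\infty$ for all $z\in\mathbb{D}$. A Koenigs function of a non-elliptic semigroup is a univalent holomorphic map $h:\mathbb{D}\to\mathbb{C}$ such that $h(\varphi_t(z))=h(z)+it$ for all $z\in\mathbb{D}$, $t\ge0$; it exists and is unique up to an additive constant. The image $\Omega=h(\mathbb{D})$ is called the planar domain of the semigroup. It is starlike at infinity, i.e. $\Omega+it\subset\Omega$ for all $t\ge0$. The trajectory $t\mapsto\varphi_t(z)$ converges to $\tau$ non-tangentially if the cluster set of $t\mapsto\mathrm{Arg}(1-\overline{\tau}\varphi_t(z))\in(-\pi/2,\pi/2)$ as $t\to+\infty$ is a compact subset of $(-\pi/2,\pi/2)$. For a domain $\Omega\subset\mathbb{C}$ starlike at infinity, $\mathsf{NP}(\Omega)$ (natural points) is the set of $p\in\mathbb{C}$ such that for some $t_0\ge0$, $p+it\in\Omega$ for all $t>t_0$. For $p\in\mathsf{NP}(\Omega)$ and $t>0$ with $p+it\in\Omega$,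 the left and right angular extents are $$\alpha^-_{\Omega,p}(t):=\min\{\pi,\ \sup\{\alpha>0: p+ite^{i\theta}\in\Omega\ \text{for all}\ \theta\in[0,\alpha]\}\},$$ $$\alpha^+_{\Omega,p}(t):=\min\{\pi,\ \sup\{\alpha>0: p+ite^{-i\theta}\in\Omega\ \text{for all}\ \theta\in[0,\alpha]\}\}.$$ They are considered on the interval $(t_0(p),+\infty)$, $t_0(p):=\inf\{t\ge0: p+it\in\Omega\}$. *)

theory Defs
  imports "HOL-Complex_Analysis.Complex_Analysis"
begin

abbreviation unit_disc :: "complex set" (\<open>\<D>\<close>) where
  "\<D> \<equiv> ball 0 1"

text \<open>Maps of the disc are total functions on \<^typ>\<open>complex\<close>, indexed by all reals; only
  nonnegative times and points of the disc are constrained.\<close>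

definition disc_semigroup :: "(real \<Rightarrow> complex \<Rightarrow> complex) \<Rightarrow> bool" where
  "disc_semigroup \<phi> \<longleftrightarrow>
     (\<forall>t\<ge>0. \<phi> t holomorphic_on \<D> \<and> \<phi> t ` \<D> \<subseteq> \<D>) \<and>
     (\<forall>z\<in>\<D>. \<phi> 0 z = z) \<and>
     (\<forall>s\<ge>0. \<forall>t\<ge>0. \<forall>z\<in>\<D>. \<phi> (s + t) z = \<phi> s (\<phi> t z)) \<and>
     (\<forall>t0\<ge>0. \<forall>K. compact K \<and> K \<subseteq> \<D> \<longrightarrow> uniform_limit K \<phi> (\<phi> t0) (at t0 within {0..}))"

definition non_elliptic :: "(real \<Rightarrow> complex \<Rightarrow> complex) \<Rightarrow> bool" where
  "non_elliptic \<phi> \<longleftrightarrow> (\<forall>t>0. \<forall>z\<in>\<D>. \<phi> t z \<noteq> z)"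

definition DW_point :: "(real \<Rightarrow> complex \<Rightarrow> complex) \<Rightarrow> complex \<Rightarrow> bool" where
  "DW_point \<phi> \<tau> \<longleftrightarrow> \<tau> \<in> sphere 0 1 \<and> (\<forall>z\<in>\<D>. ((\<lambda>t. \<phi> t z) \<longlongrightarrow> \<tau>) at_top)"

definition koenigs_function ::
    "(real \<Rightarrow> complex \<Rightarrow> complex) \<Rightarrow> (complex \<Rightarrow> complex) \<Rightarrow> bool" where
  "koenigs_function \<phi> h \<longleftrightarrow>
     h holomorphic_on \<D> \<and> inj_on h \<D> \<and>
     (\<forall>t\<ge>0. \<forall>z\<in>\<D>. h (\<phi> t z) = h z + \<i> * of_real t)"

definition cluster_set_at_top :: "(real \<Rightarrow> 'a::topological_space) \<Rightarrow> 'a set" where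
  "cluster_set_at_top f =
     {a. \<exists>s::nat \<Rightarrow> real. filterlim s at_top sequentially \<and> (\<lambda>n. f (s n)) \<longlonglongrightarrow> a}"

definition converges_non_tangentially :: "(real \<Rightarrow> complex) \<Rightarrow> complex \<Rightarrow> bool" where
  "converges_non_tangentially \<gamma> \<tau> \<longleftrightarrow>
     (\<gamma> \<longlongrightarrow> \<tau>) at_top \<and>
     (let C = cluster_set_at_top (\<lambda>t. Arg (1 - cnj \<tau> * \<gamma> t))
      in compact C \<and> C \<subseteq> {- pi / 2 <..< pi / 2})"

definition natural_points :: "complex set \<Rightarrow> complex set" where
  "natural_points \<Omega> = {p. \<exists>t0\<ge>0. \<forall>t>t0. p + \<i> * of_real t \<in> \<Omega>}"

text \<open>The supremum is taken in the extended reals, because it is infinite when the whole circle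
  of radius \<open>t\<close> about \<open>p\<close> lies in \<open>\<Omega>\<close>. For open \<open>\<Omega>\<close> the extents are meaningful, and then
  positive, only when \<open>p + \<i> t \<in> \<Omega>\<close>; otherwise the set is empty and both are \<open>0\<close>.\<close>

definition left_extent :: "complex set \<Rightarrow> complex \<Rightarrow> real \<Rightarrow> real" where
  "left_extent \<Omega> p t = real_of_ereal (min (ereal pi) (Sup (ereal ` {\<alpha>. \<alpha> > 0 \<and>
     (\<forall>\<theta>\<in>{0..\<alpha>}. p + \<i> * of_real t * exp (\<i> * of_real \<theta>) \<in> \<Omega>)})))"

definition right_extent :: "complex set \<Rightarrow> complex \<Rightarrow> real \<Rightarrow> real" where
  "right_extent \<Omega> p t = real_of_ereal (min (ereal pi) (Sup (ereal ` {\<alpha>. \<alpha> > 0 \<and>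
     (\<forall>\<theta>\<in>{0..\<alpha>}. p + \<i> * of_real t * exp (- \<i> * of_real \<theta>) \<in> \<Omega>)})))"

end

theory Submission
  imports Defs
begin

text \<open>
  Move the Denjoy-Wolff point to infinity by a Cayley transform of the disc onto the right
  half-plane, and normalise the Koenigs function so that \<open>p\<close> becomes \<open>0\<close> and the semigroup becomes
  translation by real numbers.  The result is a univalent map \<open>M\<close> of the right half-plane onto a
  domain \<open>N\<close> with \<open>N + s \<subseteq> N\<close> for \<open>s \<ge> 0\<close>, containing a real half-line; its inverse is \<open>F\<close>, its
  derivative is \<open>q\<close>.  Julia's lemma says that \<open>Re F\<close> does not decrease under translation, hence
  \<open>Re q \<ge> 0\<close> (\<open>Re_q_nonneg\<close>).  This positivity is what makes an elementary proof
  possible: by Schwarz-Pick, \<open>q\<close> varies on a hyperbolic ball about \<open>z\<close> by at most a constant times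
  \<open>Re (q z)\<close>.  So wherever \<open>Re (q z)\<close> is tiny compared with \<open>\<bar>q z\<bar>\<close>, the map \<open>M\<close> is nearly affine on a
  huge hyperbolic ball, and \<open>N\<close> looks there like a half-plane bounded by a horizontal line
  (\<open>solve_far\<close>).

  Non-tangential convergence means that \<open>F x\<close> stays in a cone \<open>\<bar>Im\<bar> \<le> C Re\<close> for large real
  \<open>x\<close>.  It is equivalent to a lower bound \<open>e \<bar>q\<bar> \<le> Re q\<close> along this orbit:
  if the bound fails, then the orbit runs almost parallel to the imaginary axis for a long
  hyperbolic time and leaves the cone (\<open>slope_if_in_cone\<close>); if it holds, integrating
  \<open>F' = 1 / q\<close> confines the orbit to a cone (\<open>cone_if_slope\<close>).

  It remains to compare this slope bound with the extents.  Since the complement of \<open>N\<close> is invariant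
  under translation to the left, the doubling hypothesis on the extents turns the arc of opening
  \<open>\<alpha>\<close> at radius \<open>t\<close> into a whole half-strip of height comparable to \<open>t \<alpha>\<close> inside \<open>N\<close>
  (\<open>half_strip\<close>).

  If the extents are comparable, then about \<open>t\<close> there is a disc in \<open>N\<close> whose radius is comparable to
  the distance from \<open>t\<close> to some complementary point above, or not far below, the real axis, and to
  another one below, or not far above, it.  Hence \<open>N\<close> cannot
  resemble a half-plane near \<open>t\<close> in either direction, and the slope bound follows
  (\<open>slope_if_surrounded\<close>, \<open>slope_if_extents_comparable\<close>).

  Conversely, suppose the slope bound holds but the extent on one side is much smaller than on the
  other.  By the doubling hypothesis the near boundary accompanies the real axis at distance
  about \<open>d\<close> over a length \<open>l\<close> much larger than \<open>d\<close>, so that \<open>Re F\<close> grows by a factor exponential in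
  \<open>l / d\<close>.  But discs of radius \<open>l\<close> fit into \<open>N\<close> on the other side, and Harnack's inequality
  allows only growth polynomial in \<open>l / d\<close> (\<open>narrow_passage_bound\<close>,
  \<open>extents_comparable_if_slope\<close>).
\<close>

section \<open>Schwarz-Pick estimates for maps into the right half-plane\<close>

text \<open>Divided by \<open>\<bar>a + cnj b\<bar>\<^sup>2\<close>, this computes one minus the square of the pseudo-hyperbolic distance
  \<open>\<bar>a - b\<bar> / \<bar>a + cnj b\<bar>\<close> of the right half-plane.\<close>

lemma cnj_sum_minus_diff:
  "(cmod (a + cnj b))\<^sup>2 = (cmod (a - b))\<^sup>2 + 4 * Re a * Re b"
  unfolding cmod_power2 by (simp add: algebra_simps power2_eq_square)

lemma cnj_sum_gt_diff:
  assumes "Re a > 0" "Re b > 0"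
  shows "cmod (a - b) < cmod (a + cnj b)"
proof -
  have "(cmod (a - b))\<^sup>2 < (cmod (a + cnj b))\<^sup>2"
    using assms by (simp add: cnj_sum_minus_diff)
  then show ?thesis by (rule power_less_imp_less_base) simp
qed

text \<open>The Schwarz lemma for \<open>f\<close> followed by the Moebius map of the half-plane onto the disc that
  sends \<open>f c\<close> to \<open>0\<close>.\<close>

lemma schwarz_pick_disc:
  assumes holo: "f holomorphic_on ball c R" and pos: "\<And>z. z \<in> ball c R \<Longrightarrow> Re (f z) > 0"
    and z: "z \<in> ball c R"
  shows "R * cmod (f z - f c) \<le> cmod (z - c) * cmod (f z + cnj (f c))"
proof -
  have R: "R > 0" using z by (metis ball_empty empty_iff not_le)
  define g where "g w = (f (c + of_real R * w) - f c) / (f (c + of_real R * w) + cnj (f c))" for w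
  have inb: "c + of_real R * w \<in> ball c R" if "w \<in> ball 0 1" for w
    using that R by (simp add: dist_norm norm_mult)
  have c: "Re (f c) > 0" using pos R by simp
  have less: "cmod (f v - f c) < cmod (f v + cnj (f c))" if "v \<in> ball c R" for v
    using cnj_sum_gt_diff[OF pos[OF that] c] .
  have nz: "f v + cnj (f c) \<noteq> 0" if "v \<in> ball c R" for v
    using less[OF that] by auto
  have fh: "(\<lambda>w. f (c + of_real R * w)) holomorphic_on ball 0 1"
    by (rule holomorphic_on_compose_gen[unfolded o_def, OF _ holo])
       (auto intro!: holomorphic_intros inb)
  have gh: "g holomorphic_on ball 0 1"
    unfolding g_def using nz inb by (intro holomorphic_intros fh) auto
  have g0: "g 0 = 0" by (simp add: g_def)
  have g1: "norm (g w) < 1" if "norm w < 1" for w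
    using less[OF inb, of w] that nz[OF inb, of w] by (simp add: g_def norm_divide)
  define w where "w = (z - c) / of_real R"
  have w: "norm w < 1" using z R by (simp add: w_def norm_divide dist_norm norm_minus_commute)
  have zw: "c + of_real R * w = z" using R by (simp add: w_def)
  have "norm (g w) \<le> norm w" using Schwarz_Lemma(1)[OF gh g0 g1 w] .
  then have "cmod (f z - f c) / cmod (f z + cnj (f c)) \<le> cmod (z - c) / R"
    unfolding g_def zw using R by (simp add: norm_divide w_def)
  moreover have "cmod (f z + cnj (f c)) > 0" using nz[OF z] by simp
  ultimately show ?thesis using R by (simp add: field_simps)
qed

text \<open>Precomposing with the Moebius map \<open>m\<close> of the disc onto the half-plane with \<open>m 0 = w\<close> reduces
  this to the disc.\<close>

lemma schwarz_pick_halfplane: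
  assumes holo: "f holomorphic_on {z. Re z > 0}" and pos: "\<And>z. Re z > 0 \<Longrightarrow> Re (f z) > 0"
    and z: "Re z > 0" and w: "Re w > 0"
  shows "cmod (f z - f w) * cmod (z + cnj w) \<le> cmod (z - w) * cmod (f z + cnj (f w))"
proof -
  define m where "m v = \<i> * of_real (Im w) + of_real (Re w) * ((1 + v) / (1 - v))" for v
  have ne1: "1 - v \<noteq> 0" if "v \<in> ball 0 1" for v :: complex
    using that by auto
  have Rem: "Re (m v) > 0" if "v \<in> ball 0 1" for v
  proof -
    have "Re ((1 + v) / (1 - v)) = (1 - (cmod v)\<^sup>2) / (cmod (1 - v))\<^sup>2"
      unfolding Re_complex_div_eq_0 Re_divide cmod_power2
      by (simp add: power2_eq_square algebra_simps flip: add_divide_distrib diff_divide_distrib)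
    moreover have "(cmod v)\<^sup>2 < 1" using that by (simp add: power_less_one_iff abs_square_less_1)
    moreover have "cmod (1 - v) > 0" using ne1[OF that] by simp
    ultimately have "Re ((1 + v) / (1 - v)) > 0" by simp
    moreover have "Re (m v) = Re w * Re ((1 + v) / (1 - v))"
      unfolding m_def by (simp del: times_divide_eq_right)
    ultimately show ?thesis using w by simp
  qed
  have mh: "m holomorphic_on ball 0 1"
    unfolding m_def using ne1 by (intro holomorphic_intros) auto
  have fm: "(\<lambda>v. f (m v)) holomorphic_on ball 0 1"
    by (rule holomorphic_on_compose_gen[unfolded o_def, OF mh holo]) (use Rem in auto)
  define v where "v = (z - w) / (z + cnj w)"
  have nz: "z + cnj w \<noteq> 0" using z w by (auto simp: complex_eq_iff)
  have v: "v \<in> ball 0 1"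
    using cnj_sum_gt_diff[OF z w] nz by (simp add: v_def norm_divide)
  have 1: "1 - v = 2 * of_real (Re w) / (z + cnj w)"
    using nz complex_add_cnj[of w] by (simp add: v_def field_simps)
  have "2 * z - w + cnj w = 2 * (z - \<i> * of_real (Im w))" by (simp add: complex_eq_iff)
  then have 2: "1 + v = 2 * (z - \<i> * of_real (Im w)) / (z + cnj w)"
    using nz by (simp add: v_def add_divide_eq_iff)
  have q: "(1 + v) / (1 - v) = (z - \<i> * of_real (Im w)) / of_real (Re w)"
  proof -
    have "(2 * a / c) / (2 * b / c) = a / b" if "c \<noteq> 0" for a b c :: complex
      using that by simp
    then show ?thesis unfolding 1 2 using nz by blast
  qed
  have mv: "m v = z" unfolding m_def q using w by simp
  have m0: "m 0 = w" by (simp add: m_def complex_eq_iff)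
  have "1 * cmod (f (m v) - f (m 0)) \<le> cmod (v - 0) * cmod (f (m v) + cnj (f (m 0)))"
    by (rule schwarz_pick_disc[OF fm]) (use Rem pos v in auto)
  then have "cmod (f z - f w) \<le> cmod (z - w) / cmod (z + cnj w) * cmod (f z + cnj (f w))"
    unfolding mv m0 by (simp add: v_def norm_divide)
  then show ?thesis using nz by (simp add: field_simps)
qed

lemma halfplane_pick_Re:
  assumes holo: "f holomorphic_on {z. Re z > 0}" and pos: "\<And>z. Re z > 0 \<Longrightarrow> Re (f z) > 0"
    and z: "Re z > 0" and w: "Re w > 0"
  shows "Re z * Re w * (cmod (f z + cnj (f w)))\<^sup>2 \<le> Re (f z) * Re (f w) * (cmod (z + cnj w))\<^sup>2"
proof -
  have "(cmod (f z - f w) * cmod (z + cnj w))\<^sup>2 \<le> (cmod (z - w) * cmod (f z + cnj (f w)))\<^sup>2"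
    using schwarz_pick_halfplane[OF assms] by (intro power_mono) auto
  then show ?thesis
    unfolding power_mult_distrib cnj_sum_minus_diff by (simp add: algebra_simps)
qed

section \<open>Julia's lemma\<close>

lemma infinitely_often_nonincreasing:
  fixes x :: "nat \<Rightarrow> real"
  assumes pos: "\<And>n. x n > 0" and lim: "x \<longlonglongrightarrow> 0"
  shows "\<exists>\<^sub>F n in sequentially. x (Suc n) \<le> x n"
proof (rule ccontr)
  assume "\<not> ?thesis"
  then have "\<forall>\<^sub>F n in sequentially. x n < x (Suc n)"
    by (simp add: not_frequently not_le)
  then obtain k where k: "\<And>n. n \<ge> k \<Longrightarrow> x n < x (Suc n)"
    by (auto simp: eventually_sequentially)
  have "x k \<le> x n" if "n \<ge> k" for n
    using that by (induction rule: dec_induct) (use k in force)+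
  then have "x k \<le> 0"
    by (intro LIMSEQ_le_const[OF lim]) auto
  then show False using pos[of k] by simp
qed

text \<open>Schwarz-Pick between \<open>z\<close> and the orbit point \<open>w n\<close> reads, after division by
  \<open>\<bar>w n\<bar>\<^sup>2\<close> and \<open>\<bar>w (n + 1)\<bar>\<^sup>2\<close>, up to factors tending to \<open>1\<close>, as \<open>Re z * x n \<le> Re (f z) * x (n + 1)\<close> with
  \<open>x n = Re (w n) / \<bar>w n\<bar>\<^sup>2 = Re (1 / w n)\<close>.  These positive numbers tend to \<open>0\<close>, so infinitely often
  \<open>x (n + 1) \<le> x n\<close>, and the limit along those \<open>n\<close> gives the claim.\<close>

lemma julia_halfplane:
  assumes holo: "f holomorphic_on {z. Re z > 0}" and pos: "\<And>z. Re z > 0 \<Longrightarrow> Re (f z) > 0"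
    and z: "Re z > 0" and w: "\<And>n. Re (w n) > 0" and step: "\<And>n. f (w n) = w (Suc n)"
    and esc: "filterlim w at_infinity sequentially"
  shows "Re z \<le> Re (f z)"
proof -
  define x where "x n = Re (w n) / (cmod (w n))\<^sup>2" for n
  have wn: "w n \<noteq> 0" for n using w[of n] by auto
  have x: "x n > 0" for n using w[of n] wn[of n] by (simp add: x_def)
  have inv0: "(\<lambda>n. inverse (w n)) \<longlonglongrightarrow> 0"
    using tendsto_inverse_0 esc by (rule filterlim_compose)
  have "x = (\<lambda>n. Re (inverse (w n)))"
    by (simp add: x_def fun_eq_iff cmod_power2)
  with tendsto_Re[OF inv0] have "x \<longlonglongrightarrow> 0" by simp
  then have freq: "\<exists>\<^sub>F n in sequentially. x (Suc n) \<le> x n"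
    by (rule infinitely_often_nonincreasing[OF x])
  define L where "L n = Re z * (cmod (f z * inverse (cnj (w (Suc n))) + 1))\<^sup>2" for n
  define U where "U n = Re (f z) * (cmod (z * inverse (cnj (w n)) + 1))\<^sup>2" for n
  have LU: "L n \<le> U n" if "x (Suc n) \<le> x n" for n
  proof -
    have "Re z * Re (w n) * (cmod (f z + cnj (w (Suc n))))\<^sup>2
        \<le> Re (f z) * Re (w (Suc n)) * (cmod (z + cnj (w n)))\<^sup>2"
      using halfplane_pick_Re[OF holo pos z w[of n]] step by simp
    moreover have "f z + cnj (w (Suc n)) = (f z * inverse (cnj (w (Suc n))) + 1) * cnj (w (Suc n))"
      "z + cnj (w n) = (z * inverse (cnj (w n)) + 1) * cnj (w n)"
      using wn by (auto simp: field_simps)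
    ultimately have "L n * (Re (w n) * (cmod (w (Suc n)))\<^sup>2) \<le> U n * (Re (w (Suc n)) * (cmod (w n))\<^sup>2)"
      unfolding L_def U_def by (simp only: norm_mult power_mult_distrib complex_mod_cnj mult_ac)
    then have "L n * x n \<le> U n * x (Suc n)"
      using wn[of n] wn[of "Suc n"] by (simp add: x_def field_simps)
    also have "\<dots> \<le> U n * x n"
      using that pos[OF z] by (intro mult_left_mono) (auto simp: U_def)
    finally show ?thesis using x[of n] by simp
  qed
  have i1: "(\<lambda>n. inverse (cnj (w n))) \<longlonglongrightarrow> 0"
    using tendsto_cnj[OF inv0] by simp
  have i2: "(\<lambda>n. inverse (cnj (w (Suc n)))) \<longlonglongrightarrow> 0"
    using i1 by (rule LIMSEQ_Suc)
  have "L \<longlonglongrightarrow> Re z * (cmod (f z * 0 + 1))\<^sup>2" "U \<longlonglongrightarrow> Re (f z) * (cmod (z * 0 + 1))\<^sup>2"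
    unfolding L_def U_def by (intro tendsto_intros i1 i2)+
  then have "(\<lambda>n. U n - L n) \<longlonglongrightarrow> Re (f z) - Re z"
    by (auto intro!: tendsto_eq_intros)
  moreover have "\<exists>\<^sub>F n in sequentially. U n - L n \<ge> 0"
    using freq by (rule frequently_elim1) (use LU in auto)
  ultimately have "\<not> Re (f z) - Re z < 0"
    using order_tendstoD(2)[of "\<lambda>n. U n - L n" "Re (f z) - Re z" sequentially 0]
    unfolding frequently_def by (auto simp: not_le)
  then show ?thesis by simp
qed

text \<open>For positive real part, Schwarz-Pick bounds the oscillation of \<open>q\<close> by \<open>Re (q w)\<close>
  rather than by \<open>\<bar>q w\<bar>\<close>.  Adding a small \<open>e\<close> makes room for \<open>Re q \<ge> 0\<close> in place of \<open>Re q > 0\<close>.\<close>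

lemma positive_variation_bound:
  assumes holo: "q holomorphic_on {z. Re z > 0}" and pos: "\<And>z. Re z > 0 \<Longrightarrow> Re (q z) \<ge> 0"
    and z: "Re z > 0" and w: "Re w > 0"
  shows "cmod (q z - q w) * (cmod (z + cnj w) - cmod (z - w)) \<le> 2 * cmod (z - w) * Re (q w)"
proof -
  have *: "cmod (q z - q w) * (cmod (z + cnj w) - cmod (z - w)) \<le> 2 * cmod (z - w) * (Re (q w) + e)"
    if e: "e > 0" for e :: real
  proof -
    have "cmod ((q z + of_real e) - (q w + of_real e)) * cmod (z + cnj w)
       \<le> cmod (z - w) * cmod ((q z + of_real e) + cnj (q w + of_real e))"
      by (rule schwarz_pick_halfplane[where f = "\<lambda>z. q z + of_real e"])
         (use pos z w e holo in \<open>auto intro!: holomorphic_intros add_nonneg_pos\<close>)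
    also have "(q z + of_real e) + cnj (q w + of_real e) = (q z - q w) + of_real (2 * (Re (q w) + e))"
      by (simp add: complex_eq_iff)
    also have "cmod (z - w) * cmod \<dots> \<le> cmod (z - w) * (cmod (q z - q w) + 2 * (Re (q w) + e))"
    proof (rule mult_left_mono)
      have "cmod (of_real (2 * (Re (q w) + e))) = 2 * (Re (q w) + e)"
        using pos[OF w] e by (simp only: norm_of_real) simp
      then show "cmod ((q z - q w) + of_real (2 * (Re (q w) + e))) \<le> cmod (q z - q w) + 2 * (Re (q w) + e)"
        using norm_triangle_ineq[of "q z - q w" "of_real (2 * (Re (q w) + e))"] by simp
    qed simp
    finally have "cmod (q z - q w) * cmod (z + cnj w)
        \<le> cmod (z - w) * (cmod (q z - q w) + 2 * (Re (q w) + e))"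
      by (simp del: mult_le_cancel_left)
    then show ?thesis by (simp add: algebra_simps)
  qed
  have "((\<lambda>e. 2 * cmod (z - w) * (Re (q w) + e)) \<longlongrightarrow> 2 * cmod (z - w) * (Re (q w) + 0)) (at_right 0)"
    by (intro tendsto_intros)
  moreover have "\<forall>\<^sub>F e in at_right 0. cmod (q z - q w) * (cmod (z + cnj w) - cmod (z - w)) \<le> 2 * cmod (z - w) * (Re (q w) + e)"
    using eventually_at_right_less[of "0::real"] by eventually_elim (use * in auto)
  ultimately have "2 * cmod (z - w) * (Re (q w) + 0) \<ge> cmod (q z - q w) * (cmod (z + cnj w) - cmod (z - w))"
    by (rule tendsto_lowerbound) simp
  then show ?thesis by simp
qed

section \<open>Equations for nearly affine maps\<close>

text \<open>If \<open>M\<close> is close to the affine map \<open>z \<mapsto> M z0 + a (z - z0)\<close>, then \<open>M z = w\<close> has a solution close to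
  the solution of the affine equation, because the Newton map \<open>z \<mapsto> z - (M z - w) / a\<close> sends the
  ball about the affine solution into itself.\<close>

lemma brouwer_solve_near_affine:
  fixes M :: "complex \<Rightarrow> complex"
  assumes "convex S" and der: "\<And>z. z \<in> S \<Longrightarrow> (M has_field_derivative q z) (at z within S)"
    and dev: "\<And>z. z \<in> S \<Longrightarrow> cmod (q z - a) \<le> B"
    and "z0 \<in> S" "a \<noteq> 0" "r \<ge> 0" and sub: "cball (z0 + (w - M z0) / a) r \<subseteq> S"
    and small: "\<And>z. z \<in> cball (z0 + (w - M z0) / a) r \<Longrightarrow> B * cmod (z - z0) \<le> r * cmod a"
  shows "\<exists>z \<in> cball (z0 + (w - M z0) / a) r. M z = w"
proof -
  define c where "c = z0 + (w - M z0) / a"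
  define g where "g z = z - (M z - w) / a" for z
  have bd: "cmod ((M z - a * z) - (M z0 - a * z0)) \<le> B * cmod (z - z0)" if "z \<in> S" for z
    by (rule field_differentiable_bound[OF \<open>convex S\<close>, where f' = "\<lambda>z. q z - a"])
       (use assms that in \<open>auto intro!: derivative_eq_intros\<close>)
  have "continuous_on S M"
    using der by (meson DERIV_continuous_on)
  then have cont: "continuous_on (cball c r) g"
    unfolding g_def using \<open>a \<noteq> 0\<close> sub
    by (auto intro!: continuous_intros intro: continuous_on_subset simp: c_def)
  have maps: "g z \<in> cball c r" if z: "z \<in> cball c r" for z
  proof -
    have "c - g z = ((M z - a * z) - (M z0 - a * z0)) / a"
      using \<open>a \<noteq> 0\<close> by (simp add: c_def g_def field_simps)
    then have "cmod (c - g z) \<le> B * cmod (z - z0) / cmod a"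
      using bd[of z] z sub by (auto simp: norm_divide c_def divide_right_mono)
    also have "\<dots> \<le> r"
      using small[of z] z \<open>a \<noteq> 0\<close> by (simp add: c_def field_simps)
    finally show ?thesis by (simp add: dist_norm)
  qed
  obtain z where "z \<in> cball c r" "g z = z"
    using brouwer[OF compact_cball convex_cball _ cont] maps \<open>r \<ge> 0\<close> by (auto simp: image_subset_iff)
  then show ?thesis
    using \<open>a \<noteq> 0\<close> by (auto simp: g_def c_def)
qed

section \<open>Koenigs maps of the right half-plane\<close>

abbreviation RHP :: "complex set" where
  "RHP \<equiv> {z. Re z > 0}"

text \<open>A Koenigs function in the coordinates where the disc is the right half-plane, the Denjoy-Wolff
  point is infinity, and the semigroup acts on the image as translation by \<open>s \<ge> 0\<close>.  The
  semigroup itself is recovered as \<open>z \<mapsto> F (M z + s)\<close>, and \<open>1 / q\<close> is its infinitesimal generator.\<close>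

locale halfplane_koenigs =
  fixes M :: "complex \<Rightarrow> complex"
  assumes holo: "M holomorphic_on RHP" and inj: "inj_on M RHP"
    and shift: "\<And>z s. Re z > 0 \<Longrightarrow> s \<ge> 0 \<Longrightarrow> M z + of_real s \<in> M ` RHP"
    and escape: "\<And>z. Re z > 0 \<Longrightarrow>
      filterlim (\<lambda>s. the_inv_into RHP M (M z + of_real s)) at_infinity at_top"
begin

definition N :: "complex set" where "N = M ` RHP"
definition F :: "complex \<Rightarrow> complex" where "F = the_inv_into RHP M"
definition q :: "complex \<Rightarrow> complex" where "q = deriv M"

lemma open_RHP: "open RHP"
  by (rule open_halfspace_Re_gt)

lemma F_M [simp]: "Re z > 0 \<Longrightarrow> F (M z) = z"
  unfolding F_def by (rule the_inv_into_f_f[OF inj]) simp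

lemma M_F [simp]: "w \<in> N \<Longrightarrow> M (F w) = w"
  unfolding F_def N_def by (rule f_the_inv_into_f[OF inj])

lemma Re_F_pos [simp]: "w \<in> N \<Longrightarrow> Re (F w) > 0"
  by (auto simp: N_def)

lemma M_in_N [simp]: "Re z > 0 \<Longrightarrow> M z \<in> N"
  by (auto simp: N_def)

lemma open_N: "open N"
  unfolding N_def using open_RHP holo inj by (metis open_mapping_thm3)

lemma shift_N: "w \<in> N \<Longrightarrow> s \<ge> 0 \<Longrightarrow> w + of_real s \<in> N"
  using shift by (auto simp: N_def)

lemma M_deriv: "Re z > 0 \<Longrightarrow> (M has_field_derivative q z) (at z)"
  unfolding q_def using holomorphic_derivI[OF holo open_RHP] by simp

lemma q_holo: "q holomorphic_on RHP"
  unfolding q_def by (rule holomorphic_deriv[OF holo open_RHP])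

lemma F_holo: "F holomorphic_on N"
  and q_times_deriv_F: "Re z > 0 \<Longrightarrow> q z * deriv F (M z) = 1"
proof -
  obtain g where g: "g holomorphic_on M ` RHP" "\<And>z. z \<in> RHP \<Longrightarrow> deriv M z * deriv g (M z) = 1"
    "\<And>z. z \<in> RHP \<Longrightarrow> g (M z) = z"
    using holomorphic_has_inverse[OF holo open_RHP inj] by metis
  have eq: "g w = F w" if "w \<in> N" for w
    using that g(3) by (auto simp: N_def)
  show "F holomorphic_on N"
    using g(1) unfolding N_def[symmetric] by (rule holomorphic_transform) (auto simp: eq)
  show "q z * deriv F (M z) = 1" if "Re z > 0"
  proof -
    have "deriv F (M z) = deriv g (M z)"
      by (rule deriv_cong_ev[OF _ refl], rule eventually_mono[OF eventually_nhds_in_open[OF open_N]])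
         (use that eq in auto)
    then show ?thesis using g(2) that by (simp add: q_def)
  qed
qed

lemma q_nonzero: "Re z > 0 \<Longrightarrow> q z \<noteq> 0"
  using q_times_deriv_F[of z] by auto

lemma F_deriv:
  assumes "w \<in> N"
  shows "(F has_field_derivative 1 / q (F w)) (at w)"
proof -
  have "deriv F w = 1 / q (F w)"
    using q_times_deriv_F[of "F w"] q_nonzero[of "F w"] assms by (simp add: field_simps)
  then show ?thesis using holomorphic_derivI[OF F_holo open_N assms] by simp
qed

lemma F_shift_deriv:
  assumes "w + of_real s \<in> N"
  shows "((\<lambda>s. F (w + of_real s)) has_vector_derivative 1 / q (F (w + of_real s))) (at s)"
proof -
  have "((\<lambda>s. w + of_real s) has_vector_derivative 1) (at s)"
    by (auto intro!: derivative_eq_intros)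
  from field_vector_diff_chain_at[OF this F_deriv[OF assms]] show ?thesis
    by (simp add: o_def)
qed

lemma Re_F_shift_deriv:
  assumes "w + of_real s \<in> N"
  shows "((\<lambda>s. Re (F (w + of_real s))) has_real_derivative Re (1 / q (F (w + of_real s)))) (at s)"
  using F_shift_deriv[OF assms] by (rule has_field_derivative_Re)

lemma Im_F_shift_deriv:
  assumes "w + of_real s \<in> N"
  shows "((\<lambda>s. Im (F (w + of_real s))) has_real_derivative Im (1 / q (F (w + of_real s)))) (at s)"
  using F_shift_deriv[OF assms] by (rule has_field_derivative_Im)

text \<open>Julia's lemma for the time-\<open>s\<close> map of the semigroup, whose orbits escape to infinity.\<close>

lemma Re_F_le_shift:
  assumes "w \<in> N" "s \<ge> 0"
  shows "Re (F w) \<le> Re (F (w + of_real s))"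
proof (cases "s = 0")
  case False
  then have s: "s > 0" using assms by simp
  define f where "f z = F (M z + of_real s)" for z
  have inN: "M z + of_real t \<in> N" if "Re z > 0" "t \<ge> 0" for z t
    using shift_N that by simp
  have "Re (F w) \<le> Re (f (F w))"
  proof (rule julia_halfplane[where w = "\<lambda>n. F (M 1 + of_real (real n * s))"])
    show "f holomorphic_on RHP"
      unfolding f_def
      by (rule holomorphic_on_compose_gen[unfolded o_def, OF _ F_holo])
         (use holo inN s in \<open>auto intro!: holomorphic_intros\<close>)
    show "Re (f z) > 0" if "Re z > 0" for z using inN that s by (simp add: f_def)
    show "Re (F w) > 0" using assms by simp
    show "Re (F (M 1 + of_real (real n * s))) > 0" for n using inN[of 1 "real n * s"] s by simp
    show "f (F (M 1 + of_real (real n * s))) = F (M 1 + of_real (real (Suc n) * s))" for n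
      using inN[of 1 "real n * s"] s by (simp add: f_def algebra_simps)
    have "filterlim (\<lambda>n. real n * s) at_top sequentially"
      using s filterlim_tendsto_pos_mult_at_top[OF tendsto_const s filterlim_real_sequentially]
      by (simp add: mult.commute)
    then show "filterlim (\<lambda>n. F (M 1 + of_real (real n * s))) at_infinity sequentially"
      unfolding F_def by (rule filterlim_compose[OF escape, rotated]) simp
  qed
  then show ?thesis using assms by (simp add: f_def)
qed auto

text \<open>The real part of \<open>F\<close> does not decrease along translations, so its derivative \<open>Re (1 / q)\<close> is
  nonnegative.\<close>

lemma Re_q_nonneg:
  assumes z: "Re z > 0"
  shows "Re (q z) \<ge> 0"
proof (rule ccontr)
  assume "\<not> ?thesis"
  then have "Re (1 / q z) < 0"
    using q_nonzero[OF z] by (auto simp: Re_divide intro!: divide_neg_pos simp: complex_eq_iff sum_power2_gt_zero_iff)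
  moreover have "((\<lambda>s. Re (F (M z + of_real s))) has_real_derivative Re (1 / q z)) (at 0)"
    using Re_F_shift_deriv[of "M z" 0] z by simp
  ultimately obtain d where "d > 0" "\<And>h. h > 0 \<Longrightarrow> h < d \<Longrightarrow> Re (F (M z + of_real (0 + h))) < Re (F (M z + of_real 0))"
    using DERIV_neg_dec_right[of "\<lambda>s. Re (F (M z + of_real s))"] by blast
  from this(2)[of "d / 2"] this(1) show False
    using Re_F_le_shift[of "M z" "d / 2"] z by simp
qed

text \<open>The admissible \<open>z\<close> lie at bounded hyperbolic distance from \<open>z0\<close>, with a bound that depends only on \<open>A\<close>,
  so the oscillation estimate for positive real part applies with a uniform constant.\<close>

lemma q_harnack:
  assumes z0: "Re z0 > 0" and z: "Re z \<ge> Re z0 / 4" and A: "cmod (z - z0) \<le> A * Re z0" "A \<ge> 0"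
  shows "cmod (q z - q z0) \<le> 4 * (2 + A)\<^sup>2 * Re (q z0)"
proof -
  define D d u where "D = cmod (z + cnj z0)" and "d = cmod (z - z0)" and "u = Re z0"
  have u: "u > 0" using z0 by (simp add: u_def)
  have zp: "Re z > 0" using z z0 by linarith
  have Dd: "D\<^sup>2 = d\<^sup>2 + 4 * Re z * u" unfolding D_def d_def u_def by (rule cnj_sum_minus_diff)
  have "D \<le> d + 2 * u"
  proof -
    have "z + cnj z0 = (z - z0) + of_real (2 * u)" by (simp add: u_def complex_eq_iff)
    then have "D \<le> d + cmod (of_real (2 * u))" unfolding D_def d_def by (metis norm_triangle_ineq)
    then show ?thesis using u by (simp add: norm_of_real del: of_real_mult)
  qed
  moreover have "d \<le> A * u" using A by (simp add: d_def u_def)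
  ultimately have sum: "D + d \<le> 2 * (2 + A) * u" using u by (simp add: algebra_simps)
  have "u * u \<le> 4 * Re z * u" using z u by (simp add: u_def)
  also have "\<dots> = (D - d) * (D + d)" using Dd by (simp add: algebra_simps power2_eq_square)
  also have "\<dots> \<le> (D - d) * (2 * (2 + A) * u)"
    using sum cnj_sum_gt_diff[OF zp z0] by (intro mult_left_mono) (auto simp: D_def d_def)
  finally have gap: "u \<le> (D - d) * (2 * (2 + A))" using u by (simp add: mult.assoc[symmetric])
  have pv: "cmod (q z - q z0) * (D - d) \<le> 2 * d * Re (q z0)"
    unfolding D_def d_def using positive_variation_bound[OF q_holo Re_q_nonneg zp z0] by simp
  have "cmod (q z - q z0) * u \<le> cmod (q z - q z0) * ((D - d) * (2 * (2 + A)))"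
    using gap by (intro mult_left_mono) auto
  also have "\<dots> \<le> 2 * d * Re (q z0) * (2 * (2 + A))"
    using mult_right_mono[OF pv, of "2 * (2 + A)"] A by (simp add: mult_ac)
  also have "\<dots> \<le> 2 * ((2 + A) * u) * Re (q z0) * (2 * (2 + A))"
    using \<open>d \<le> A * u\<close> u A Re_q_nonneg[OF z0]
    by (intro mult_right_mono mult_left_mono) (simp_all add: algebra_simps)
  also have "\<dots> = (4 * (2 + A)\<^sup>2 * Re (q z0)) * u" by (simp add: power2_eq_square)
  finally show ?thesis using u by simp
qed

text \<open>The threshold for \<open>Re q / \<bar>q\<bar>\<close> below which \<open>M\<close> is nearly affine on the hyperbolic ball of
  Euclidean size \<open>A * Re z0\<close>; its value is what the Harnack constant in \<open>q_harnack\<close> dictates.\<close>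

definition eta :: "real \<Rightarrow> real" where
  "eta A = 1 / (16 * A * (2 + A)\<^sup>2)"

text \<open>Where \<open>q z0\<close> is nearly imaginary, \<open>M\<close> takes every value that its linearisation at \<open>z0\<close>
  takes well inside the half-plane, even at Euclidean distance \<open>(A - 1) * Re z0\<close> from \<open>z0\<close>.\<close>

lemma solve_far:
  assumes z0: "Re z0 > 0" and A: "A \<ge> 1"
    and flat: "Re (q z0) \<le> eta A * cmod (q z0)"
    and c: "c = z0 + (w - M z0) / q z0" "cmod (c - z0) \<le> (A - 1) * Re z0" "Re c \<ge> Re z0 / 2"
  shows "\<exists>z \<in> cball c (Re z0 / 4). Re z > 0 \<and> M z = w"
proof -
  define u S where "u = Re z0" and "S = {z. Re z \<ge> u / 4} \<inter> cball z0 (A * u)"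
  have u: "u > 0" using z0 by (simp add: u_def)
  have SD: "Re z > 0" if "z \<in> S" for z using that u by (auto simp: S_def)
  have B: "4 * (2 + A)\<^sup>2 * Re (q z0) * A \<le> cmod (q z0) / 4"
    using mult_left_mono[OF flat, of "4 * (2 + A)\<^sup>2 * A"] A
    by (simp add: eta_def field_simps)
  have sub: "cball c (u / 4) \<subseteq> S"
  proof
    fix z assume z: "z \<in> cball c (u / 4)"
    then have zc: "cmod (z - c) \<le> u / 4" by (simp add: dist_norm norm_minus_commute)
    then have "\<bar>Re z - Re c\<bar> \<le> u / 4" using abs_Re_le_cmod[of "z - c"] by simp
    then have "Re z \<ge> u / 4" using c(3) unfolding u_def by linarith
    moreover have "cmod (z - z0) \<le> A * u"
      using norm_triangle_ineq[of "z - c" "c - z0"] zc c(2) u by (simp add: u_def algebra_simps)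
    ultimately show "z \<in> S" by (simp add: S_def dist_norm norm_minus_commute)
  qed
  have "\<exists>z \<in> cball (z0 + (w - M z0) / q z0) (u / 4). M z = w"
  proof (rule brouwer_solve_near_affine[where q = q and B = "4 * (2 + A)\<^sup>2 * Re (q z0)" and S = S])
    show "convex S" unfolding S_def by (intro convex_Int convex_cball convex_halfspace_Re_ge)
    show "(M has_field_derivative q z) (at z within S)" if "z \<in> S" for z
      using M_deriv[OF SD[OF that]] by (rule has_field_derivative_at_within)
    show "cmod (q z - q z0) \<le> 4 * (2 + A)\<^sup>2 * Re (q z0)" if "z \<in> S" for z
      using that A z0 by (intro q_harnack) (auto simp: S_def u_def dist_norm norm_minus_commute)
    show "z0 \<in> S" using u A by (simp add: S_def u_def)
    show "q z0 \<noteq> 0" by (rule q_nonzero[OF z0])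
    show "u / 4 \<ge> 0" using u by simp
    show "cball (z0 + (w - M z0) / q z0) (u / 4) \<subseteq> S" using sub c(1) by simp
    show "4 * (2 + A)\<^sup>2 * Re (q z0) * cmod (z - z0) \<le> u / 4 * cmod (q z0)"
      if "z \<in> cball (z0 + (w - M z0) / q z0) (u / 4)" for z
    proof -
      have "z \<in> S" using that sub c(1) by auto
      then have "cmod (z - z0) \<le> A * u" by (simp add: S_def dist_norm norm_minus_commute)
      then have "4 * (2 + A)\<^sup>2 * Re (q z0) * cmod (z - z0) \<le> 4 * (2 + A)\<^sup>2 * Re (q z0) * (A * u)"
        using Re_q_nonneg[OF z0] by (intro mult_left_mono) auto
      also have "\<dots> \<le> u / 4 * cmod (q z0)"
        using mult_right_mono[OF B, of u] u by (simp add: mult_ac)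
      finally show ?thesis .
    qed
  qed
  then show ?thesis using SD sub c(1) by (fastforce simp: u_def)
qed

text \<open>A Koebe-type covering estimate.  Since \<open>Re q \<ge> 0\<close>, the derivative changes on the disc of
  radius \<open>Re z0 / 3\<close> by at most half of \<open>\<bar>q z0\<bar>\<close>, which makes the linearisation dominant.\<close>

lemma covers_ball:
  assumes z0: "Re z0 > 0"
  shows "cball (M z0) (Re z0 * cmod (q z0) / 6) \<subseteq> N"
proof
  fix w assume w: "w \<in> cball (M z0) (Re z0 * cmod (q z0) / 6)"
  define u where "u = Re z0"
  have u: "u > 0" using z0 by (simp add: u_def)
  have SD: "Re z > 0" if "z \<in> cball z0 (u / 3)" for z
    using that u abs_Re_le_cmod[of "z0 - z"] by (auto simp: u_def dist_norm)
  have q0: "q z0 \<noteq> 0" by (rule q_nonzero[OF z0])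
  define c where "c = z0 + (w - M z0) / q z0"
  have "cmod (c - z0) \<le> u / 6"
    using w q0 by (simp add: c_def norm_divide dist_norm norm_minus_commute u_def field_simps)
  then have sub: "cball c (u / 6) \<subseteq> cball z0 (u / 3)"
    by (simp add: cball_subset_cball_iff dist_norm)
  have "\<exists>z \<in> cball (z0 + (w - M z0) / q z0) (u / 6). M z = w"
  proof (rule brouwer_solve_near_affine[where q = q and B = "cmod (q z0) / 2" and S = "cball z0 (u / 3)"])
    show "(M has_field_derivative q z) (at z within cball z0 (u / 3))" if "z \<in> cball z0 (u / 3)" for z
      using M_deriv[OF SD[OF that]] by (rule has_field_derivative_at_within)
    show "cmod (q z - q z0) \<le> cmod (q z0) / 2" if z: "z \<in> cball z0 (u / 3)" for z
    proof -
      define d where "d = cmod (z - z0)"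
      have d: "d \<le> u / 3" using z by (simp add: d_def dist_norm norm_minus_commute)
      have "cmod (z + cnj z0) \<ge> Re (z + cnj z0)" by (rule complex_Re_le_cmod)
      moreover have "Re z \<ge> u - d" using abs_Re_le_cmod[of "z - z0"] by (simp add: d_def u_def)
      ultimately have "cmod (z + cnj z0) - d \<ge> 2 * u - 2 * d" by (simp add: u_def)
      also have "2 * u - 2 * d \<ge> 4 * d" using d by simp
      finally have "cmod (q z - q z0) * (4 * d) \<le> cmod (q z - q z0) * (cmod (z + cnj z0) - d)"
        by (intro mult_left_mono) auto
      also have "\<dots> \<le> 2 * d * Re (q z0)"
        unfolding d_def using positive_variation_bound[OF q_holo Re_q_nonneg SD[OF z] z0] by simp
      also have "\<dots> \<le> 2 * d * cmod (q z0)"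
        by (intro mult_left_mono complex_Re_le_cmod) (simp add: d_def)
      finally show ?thesis by (cases "d = 0") (auto simp: d_def)
    qed
    show "cmod (q z0) / 2 * cmod (z - z0) \<le> u / 6 * cmod (q z0)"
      if "z \<in> cball (z0 + (w - M z0) / q z0) (u / 6)" for z
    proof -
      have "z \<in> cball z0 (u / 3)" using sub that by (auto simp: c_def)
      then have "cmod (z - z0) \<le> u / 3" by (simp add: dist_norm norm_minus_commute)
      then show ?thesis using mult_left_mono[of "cmod (z - z0)" "u / 3" "cmod (q z0) / 2"] by (simp add: mult_ac)
    qed
  qed (use u q0 sub in \<open>auto simp: c_def\<close>)
  then obtain z where z: "z \<in> cball c (u / 6)" "M z = w" by (auto simp: c_def)
  then have "Re z > 0" using SD sub by blast
  then show "w \<in> N" using z M_in_N by metis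
qed

text \<open>Harnack's inequality for the positive harmonic function \<open>Re F\<close>, with the constants that a
  disc gives.\<close>

lemma Re_F_harnack:
  assumes sub: "ball c R \<subseteq> N" and z: "z \<in> ball c R"
  shows "Re (F z) * (R - cmod (z - c)) \<le> Re (F c) * (R + cmod (z - c))"
    and "Re (F c) * (R - cmod (z - c)) \<le> Re (F z) * (R + cmod (z - c))"
proof -
  define r D where "r = cmod (z - c)" and "D = cmod (F z - F c)"
  have rR: "r < R" using z by (simp add: r_def dist_norm norm_minus_commute)
  have r0: "r \<ge> 0" by (simp add: r_def)
  have cN: "c \<in> N" using sub rR r0 by auto
  have zN: "z \<in> N" using sub z by auto
  have sp: "R * D \<le> r * cmod (F z + cnj (F c))"
    unfolding D_def r_def
    by (rule schwarz_pick_disc) (use F_holo sub z in \<open>auto intro: holomorphic_on_subset\<close>)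
  have sq: "(R * D)\<^sup>2 \<le> r\<^sup>2 * (D\<^sup>2 + 4 * Re (F z) * Re (F c))"
    using power_mono[OF sp, of 2] rR r0 by (simp add: power_mult_distrib cnj_sum_minus_diff D_def)
  have RD: "\<bar>Re (F z) - Re (F c)\<bar> \<le> D"
    using abs_Re_le_cmod[of "F z - F c"] by (simp add: D_def)
  define x y where "x = Re (F z)" and "y = Re (F c)"
  have xy: "x > 0" "y > 0" using cN zN by (auto simp: x_def y_def)
  have "(R\<^sup>2 - r\<^sup>2) * (x - y)\<^sup>2 \<le> (R\<^sup>2 - r\<^sup>2) * D\<^sup>2"
    using RD rR r0 by (intro mult_left_mono) (auto simp: x_def y_def abs_le_square_iff[symmetric] power_mono)
  also have "\<dots> \<le> r\<^sup>2 * (4 * x * y)"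
    using sq by (simp add: x_def y_def algebra_simps)
  finally have "(R\<^sup>2 - r\<^sup>2) * (x - y)\<^sup>2 \<le> r\<^sup>2 * (4 * x * y)" .
  then have "(R * (x - y))\<^sup>2 \<le> (r * (x + y))\<^sup>2"
    by (simp add: algebra_simps power2_eq_square)
  then have "\<bar>R * (x - y)\<bar> \<le> r * (x + y)"
    using abs_le_square_iff[of "R * (x - y)" "r * (x + y)"] r0 xy by simp
  then have "R * (x - y) \<le> r * (x + y)" "R * (y - x) \<le> r * (x + y)"
    by (auto simp: abs_le_iff algebra_simps)
  then show "Re (F z) * (R - cmod (z - c)) \<le> Re (F c) * (R + cmod (z - c))"
    "Re (F c) * (R - cmod (z - c)) \<le> Re (F z) * (R + cmod (z - c))"
    by (auto simp: x_def y_def r_def algebra_simps)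
qed

text \<open>Schwarz-Pick for \<open>F\<close> on the disc, infinitesimally at its centre.\<close>

lemma inner_radius_bound:
  assumes sub: "ball c R \<subseteq> N" and R: "R > 0"
  shows "R \<le> 2 * Re (F c) * cmod (q (F c))"
proof -
  have cN: "c \<in> N" using sub R by auto
  have der: "(F has_field_derivative 1 / q (F c)) (at c)" by (rule F_deriv[OF cN])
  have lim1: "((\<lambda>z. R * cmod ((F z - F c) / (z - c))) \<longlongrightarrow> R * cmod (1 / q (F c))) (at c)"
    using der unfolding has_field_derivative_iff by (intro tendsto_mult tendsto_norm tendsto_const)
  have "(F \<longlongrightarrow> F c) (at c)" using der DERIV_isCont isCont_def by blast
  then have lim2: "((\<lambda>z. cmod (F z + cnj (F c))) \<longlongrightarrow> cmod (F c + cnj (F c))) (at c)"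
    by (intro tendsto_intros)
  have "\<forall>\<^sub>F z in at c. R * cmod ((F z - F c) / (z - c)) \<le> cmod (F z + cnj (F c))"
  proof -
    have "\<forall>\<^sub>F z in at c. z \<in> ball c R - {c}"
      using eventually_at_in_open[of "ball c R" c] R by simp
    then show ?thesis
    proof eventually_elim
      case (elim z)
      have "R * cmod (F z - F c) \<le> cmod (z - c) * cmod (F z + cnj (F c))"
        by (rule schwarz_pick_disc) (use F_holo sub elim in \<open>auto intro: holomorphic_on_subset\<close>)
      then show ?case using elim by (simp add: norm_divide field_simps)
    qed
  qed
  then have "R * cmod (1 / q (F c)) \<le> cmod (F c + cnj (F c))"
    using lim1 lim2 by (intro tendsto_le[OF _ lim2 lim1]) auto
  also have "F c + cnj (F c) = of_real (2 * Re (F c))" by (simp add: complex_eq_iff)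
  also have "cmod \<dots> = 2 * Re (F c)" using Re_F_pos[OF cN] by (simp add: norm_of_real del: of_real_mult)
  finally have "R * cmod (1 / q (F c)) \<le> 2 * Re (F c)" .
  moreover have "cmod (q (F c)) > 0" using q_nonzero[OF Re_F_pos[OF cN]] by simp
  ultimately show ?thesis by (simp add: norm_divide pos_divide_le_eq)
qed

lemma eta_pos: "A > 0 \<Longrightarrow> eta A > 0"
  by (simp add: eta_def zero_less_mult_iff)

lemma eta_times_le:
  assumes "A \<ge> 1"
  shows "A * eta A \<le> 1 / 16"
proof -
  have "(2 + A)\<^sup>2 \<ge> 1" using assms by simp
  moreover have "A * eta A = 1 / (16 * (2 + A)\<^sup>2)" using assms by (simp add: eta_def)
  ultimately show ?thesis by (simp add: divide_le_eq)
qed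

section \<open>Orbits in a cone and the argument of the derivative\<close>

text \<open>If \<open>q\<close> is nearly imaginary at \<open>F x\<close>, then \<open>F\<close> moves along the real axis almost
  vertically.  The point \<open>x + s\<close> is chosen so that the linearised motion is about \<open>5 (C + 1) Re (F x)\<close> in
  the vertical direction while the real part at most doubles; the cone of opening \<open>C\<close> does not
  contain such a point.\<close>

lemma slope_if_in_cone:
  assumes N: "\<And>x. x \<ge> x1 \<Longrightarrow> of_real x \<in> N" and C: "C \<ge> 0"
    and cone: "\<And>x. x \<ge> x1 \<Longrightarrow> \<bar>Im (F (of_real x))\<bar> \<le> C * Re (F (of_real x))"
    and x: "x \<ge> x1"
  shows "eta (5 * C + 6) * cmod (q (F (of_real x))) \<le> Re (q (F (of_real x)))"
proof (rule ccontr)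
  define z0 a u B where "z0 = F (of_real x)" and "a = q z0" and "u = Re z0" and "B = 5 * C + 5"
  assume "\<not> ?thesis"
  then have flat: "Re a \<le> eta (B + 1) * cmod a"
    by (simp add: z0_def a_def B_def add.assoc)
  have z0: "Re z0 > 0" using N[OF x] by (simp add: z0_def)
  then have u: "u > 0" by (simp add: u_def)
  have Mz0: "M z0 = of_real x" using N[OF x] by (simp add: z0_def)
  have a: "cmod a > 0" using q_nonzero[OF z0] by (simp add: a_def)
  have Rea: "Re a \<ge> 0" using Re_q_nonneg[OF z0] by (simp add: a_def)
  have B: "B \<ge> 5" using C by (simp add: B_def)
  define s where "s = B * u * cmod a"
  have s: "s > 0" using B u a by (simp add: s_def)
  define c where "c = z0 + (of_real (x + s) - M z0) / a"
  have cz: "c - z0 = of_real (B * u / cmod a) * cnj a"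
  proof -
    have "c - z0 = of_real s / a" by (simp add: c_def Mz0)
    also have "\<dots> = of_real s * cnj a / (of_real (cmod a))\<^sup>2" by (simp add: complex_div_cnj[of _ a])
    also have "\<dots> = of_real (s / (cmod a)\<^sup>2) * cnj a" by simp
    also have "s / (cmod a)\<^sup>2 = B * u / cmod a" using a by (simp add: s_def power2_eq_square)
    finally show ?thesis .
  qed
  have eB: "B * eta (B + 1) \<le> 1 / 16"
    using eta_times_le[of "B + 1"] eta_pos[of "B + 1"] B by (simp add: algebra_simps)
  have Bflat: "B * Re a \<le> cmod a / 16"
  proof -
    have "B * Re a \<le> B * eta (B + 1) * cmod a" using mult_left_mono[OF flat, of B] B by simp
    also have "\<dots> \<le> 1 / 16 * cmod a" using eB by (intro mult_right_mono) auto
    finally show ?thesis by simp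
  qed
  have "\<exists>z \<in> cball c (Re z0 / 4). Re z > 0 \<and> M z = of_real (x + s)"
  proof (rule solve_far[of z0 "B + 1"])
    show "cmod (c - z0) \<le> (B + 1 - 1) * Re z0"
      using a B u by (simp add: cz norm_mult norm_divide u_def)
    have "Re (c - z0) \<ge> 0" unfolding cz using Rea B u by simp
    then show "Re c \<ge> Re z0 / 2" using z0 by simp
  qed (use z0 B flat in \<open>auto simp: a_def c_def\<close>)
  then obtain z where z: "cmod (z - c) \<le> u / 4" "Re z > 0" "M z = of_real (x + s)"
    by (auto simp: u_def dist_norm norm_minus_commute)
  then have zF: "z = F (of_real (x + s))" by (metis F_M)
  have cz_z: "\<bar>Re z - Re c\<bar> \<le> u / 4" "\<bar>Im z - Im c\<bar> \<le> u / 4"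
    using z(1) abs_Re_le_cmod[of "z - c"] abs_Im_le_cmod[of "z - c"] by auto
  have Rec: "Re c - u = u / cmod a * (B * Re a)" using arg_cong[OF cz, of Re] by (simp add: u_def)
  have "u / cmod a * (B * Re a) \<le> u / cmod a * (cmod a / 16)"
    using Bflat u by (intro mult_left_mono) auto
  also have "\<dots> = u / 16" using a by simp
  finally have Re_le: "Re c \<le> u + u / 16" using Rec by linarith
  have "cmod a \<le> \<bar>Re a\<bar> + \<bar>Im a\<bar>" by (rule cmod_le)
  moreover have "Re a \<le> cmod a / 16"
    using Bflat mult_right_mono[OF B Rea] Rea by linarith
  ultimately have Ima: "\<bar>Im a\<bar> \<ge> 15 / 16 * cmod a" using Rea by simp
  have "\<bar>Im c - Im z0\<bar> = B * u / cmod a * \<bar>Im a\<bar>"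
    using arg_cong[OF cz, of Im] B u a by (simp add: abs_mult)
  also have "\<dots> \<ge> B * u / cmod a * (15 / 16 * cmod a)"
    using B u a Ima by (intro mult_left_mono) auto
  finally have Imc: "\<bar>Im c - Im z0\<bar> \<ge> 15 / 16 * B * u" using a by simp
  have "15 / 16 * B * u \<le> \<bar>Im z\<bar> + \<bar>Im z0\<bar> + u / 4"
    using Imc cz_z by linarith
  also have "\<bar>Im z0\<bar> \<le> C * u" using cone[OF x] by (simp add: z0_def u_def)
  also have "\<bar>Im z\<bar> \<le> C * Re z" using cone[of "x + s"] s x by (simp add: zF)
  also have "C * Re z \<le> C * (2 * u)"
  proof (rule mult_left_mono)
    show "Re z \<le> 2 * u" using cz_z(1) Re_le u by linarith
  qed (rule C)
  finally have "15 / 16 * B * u \<le> (3 * C + 1 / 4) * u" by (simp add: algebra_simps)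
  then have "15 / 16 * B \<le> 3 * C + 1 / 4" using u by simp
  then show False using C by (simp add: B_def)
qed

text \<open>Since \<open>F' = 1 / q\<close>, the slope bound says \<open>\<bar>Im F'\<bar> \<le> Re F' / e\<close>, so both functions
  \<open>Re F / e \<plusminus> Im F\<close> are nondecreasing.\<close>

lemma cone_if_slope:
  assumes N: "\<And>x. x \<ge> x1 \<Longrightarrow> of_real x \<in> N" and e: "e > 0"
    and slope: "\<And>x. x \<ge> x1 \<Longrightarrow> e * cmod (q (F (of_real x))) \<le> Re (q (F (of_real x)))"
  shows "\<exists>C\<ge>0. \<forall>x\<ge>x1. \<bar>Im (F (of_real x))\<bar> \<le> C * Re (F (of_real x))"
proof -
  define U V where "U x = Re (F (of_real x))" and "V x = Im (F (of_real x))" for x :: real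
  have mono: "k * V x1 + U x1 / e \<le> k * V x + U x / e" if k: "\<bar>k\<bar> = 1" and x: "x \<ge> x1" for k x
  proof (rule DERIV_nonneg_imp_nondecreasing[OF x])
    fix y assume y: "x1 \<le> y" "y \<le> x"
    define a where "a = q (F (of_real y))"
    have yN: "0 + of_real y \<in> N" using N[OF y(1)] by simp
    have "((\<lambda>x. k * V x + U x / e) has_real_derivative k * Im (1 / a) + Re (1 / a) / e) (at y)"
    proof -
      have dU: "(U has_real_derivative Re (1 / a)) (at y)"
        using Re_F_shift_deriv[OF yN] by (simp add: U_def[abs_def] a_def)
      have dV: "(V has_real_derivative Im (1 / a)) (at y)"
        using Im_F_shift_deriv[OF yN] by (simp add: V_def[abs_def] a_def)
      show ?thesis by (intro DERIV_add DERIV_cmult DERIV_cdivide dU dV)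
    qed
    moreover have "k * Im (1 / a) + Re (1 / a) / e \<ge> 0"
    proof -
      have "cmod a \<le> Re a / e" using slope[OF y(1)] e by (simp add: a_def field_simps)
      then have "\<bar>k * Im a\<bar> \<le> Re a / e" using abs_Im_le_cmod[of a] k by (simp add: abs_mult)
      then have "0 \<le> (Re a / e - k * Im a) / (cmod a)\<^sup>2" by simp
      also have "\<dots> = k * Im (1 / a) + Re (1 / a) / e"
        by (simp add: Re_divide Im_divide cmod_power2 diff_divide_distrib)
      finally show ?thesis .
    qed
    ultimately show "\<exists>d. ((\<lambda>x. k * V x + U x / e) has_real_derivative d) (at y) \<and> 0 \<le> d" by blast
  qed
  define C where "C = \<bar>V x1\<bar> / U x1 + 1 / e"
  have Up: "U x > 0" if "x \<ge> x1" for x using N[OF that] by (simp add: U_def)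
  have "\<bar>V x\<bar> \<le> C * U x" if x: "x \<ge> x1" for x
  proof -
    have "U x1 \<le> U x" using Re_F_le_shift[OF N[of x1], of "x - x1"] x by (simp add: U_def)
    then have "\<bar>V x1\<bar> \<le> \<bar>V x1\<bar> / U x1 * U x"
      using Up[of x1] mult_left_mono[of "U x1" "U x" "\<bar>V x1\<bar> / U x1"] by simp
    moreover have "\<bar>V x\<bar> \<le> \<bar>V x1\<bar> + U x / e"
    proof -
      have "U x1 / e \<ge> 0" using Up[of x1] e by simp
      then show ?thesis using mono[of 1 x] mono[of "-1" x] x by simp
    qed
    ultimately show ?thesis by (simp add: C_def algebra_simps)
  qed
  moreover have "C \<ge> 0" using Up[of x1] e by (simp add: C_def)
  ultimately show ?thesis unfolding U_def V_def by blast
qed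

section \<open>Barriers near the real axis\<close>

text \<open>Otherwise \<open>M\<close> is nearly affine about \<open>F x\<close> with nearly imaginary derivative, and \<open>N\<close> contains
  a large part of a half-plane bounded by a horizontal line.  The line is at distance at least
  about \<open>R / 2\<close> from \<open>x\<close>, because \<open>Re (F x) \<bar>q\<bar> \<ge> R / 2\<close>.  The barrier \<open>w\<close> on the corresponding side would be one of the values
  provided by \<open>solve_far\<close>.\<close>

lemma slope_if_surrounded:
  assumes sub: "ball (of_real x) R \<subseteq> N" and R: "R > 0" and C: "C \<ge> 0"
    and barrier: "\<And>k. \<bar>k\<bar> = 1 \<Longrightarrow> \<exists>w. w \<notin> N \<and> cmod (w - of_real x) \<le> C * R \<and> k * Im w \<ge> - R / 8"
  shows "eta (2 * C + 1) * cmod (q (F (of_real x))) \<le> Re (q (F (of_real x)))"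
proof (rule ccontr)
  define z0 a u A where "z0 = F (of_real x)" and "a = q z0" and "u = Re z0" and "A = 2 * C + 1"
  assume "\<not> ?thesis"
  then have flat: "Re a \<le> eta A * cmod a" by (simp add: z0_def a_def A_def)
  have xN: "of_real x \<in> N" using sub R by auto
  have z0: "Re z0 > 0" using xN by (simp add: z0_def)
  then have u: "u > 0" by (simp add: u_def)
  have Mz0: "M z0 = of_real x" using xN by (simp add: z0_def)
  have a: "cmod a > 0" using q_nonzero[OF z0] by (simp add: a_def)
  have Rea: "Re a \<ge> 0" using Re_q_nonneg[OF z0] by (simp add: a_def)
  have A: "A \<ge> 1" using C by (simp add: A_def)
  have Ru: "R \<le> 2 * u * cmod a" using inner_radius_bound[OF sub R] by (simp add: u_def a_def z0_def)
  \<comment> \<open>The linearised image \<open>z \<mapsto> x + a (z - z0)\<close> of the half-plane extends in the direction of \<open>a\<close>.\<close>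
  define k where "k = (if Im a \<ge> 0 then 1 else -1::real)"
  have "\<bar>k\<bar> = 1" by (simp add: k_def)
  then obtain w where w: "w \<notin> N" "cmod (w - of_real x) \<le> C * R" "k * Im w \<ge> - R / 8"
    using barrier by blast
  define c where "c = z0 + (w - M z0) / a"
  have dist: "cmod (c - z0) \<le> (A - 1) * u"
  proof -
    have "cmod (c - z0) = cmod (w - of_real x) / cmod a" by (simp add: c_def Mz0 norm_divide)
    also have "\<dots> \<le> C * (2 * u * cmod a) / cmod a"
      using w(2) mult_left_mono[OF Ru C] a by (intro divide_right_mono) auto
    also have "\<dots> = (A - 1) * u" using a by (simp add: A_def)
    finally show ?thesis .
  qed
  have "Re c \<ge> u / 2"
  proof -
    have CA: "C * eta A \<le> 1 / 16"
      using eta_times_le[OF A] eta_pos[of A] A C by (simp add: A_def algebra_simps)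
    have "\<bar>Re (w - of_real x) * Re a\<bar> \<le> (C * R) * (eta A * cmod a)"
      unfolding abs_mult using abs_Re_le_cmod[of "w - of_real x"] w(2) Rea flat
      by (intro mult_mono) auto
    also have "\<dots> \<le> 1 / 16 * (R * cmod a)"
      using mult_right_mono[OF CA, of "R * cmod a"] R by (simp add: mult_ac)
    finally have t1: "Re (w - of_real x) * Re a \<ge> - (R * cmod a / 16)" by (simp add: abs_le_iff)
    have "Im w * Im a = (k * Im w) * \<bar>Im a\<bar>" by (simp add: k_def)
    also have "\<dots> \<ge> (- R / 8) * \<bar>Im a\<bar>" using w(3) by (intro mult_right_mono) auto
    also have "(- R / 8) * \<bar>Im a\<bar> \<ge> (- R / 8) * cmod a"
      using R abs_Im_le_cmod[of a] by (intro mult_left_mono_neg) auto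
    finally have t2: "Im w * Im a \<ge> - (R * cmod a / 8)" by simp
    have "R * cmod a \<le> 2 * u * cmod a * cmod a" using Ru a by (intro mult_right_mono) auto
    then have "- (u / 2) * (cmod a)\<^sup>2 \<le> Re (w - of_real x) * Re a + Im w * Im a"
    proof -
      have "R * cmod a \<le> 2 * (u * (cmod a)\<^sup>2)"
        using \<open>R * cmod a \<le> 2 * u * cmod a * cmod a\<close> by (simp add: power2_eq_square mult_ac)
      moreover have "u * (cmod a)\<^sup>2 \<ge> 0" using u by simp
      moreover have "- (u / 2) * (cmod a)\<^sup>2 = - (u * (cmod a)\<^sup>2) / 2" by simp
      ultimately show ?thesis using t1 t2 by linarith
    qed
    then have "- (u / 2) \<le> (Re (w - of_real x) * Re a + Im w * Im a) / (cmod a)\<^sup>2"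
      using a by (simp add: pos_le_divide_eq)
    also have "\<dots> = Re (c - z0)" by (simp add: c_def Mz0 Re_divide cmod_power2)
    finally show ?thesis by (simp add: u_def)
  qed
  then have "\<exists>z \<in> cball c (Re z0 / 4). Re z > 0 \<and> M z = w"
    by (intro solve_far[OF z0 A]) (use flat dist in \<open>auto simp: a_def c_def u_def\<close>)
  then show False using w(1) M_in_N by metis
qed

text \<open>The barriers give \<open>Re F \<le> 6 C d / \<bar>q\<bar>\<close> along the passage by \<open>covers_ball\<close>, so with the slope bound
  \<open>ln (Re F)\<close> has derivative at least \<open>e / (6 C d)\<close>.  On the other hand, the two ends of the
  passage lie at depth \<open>d\<close> in discs of radius \<open>l + d\<close> whose centres are close to each other relative
  to the radius.  The unit vector \<open>b\<close> points to the side on which these discs lie.\<close>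

lemma narrow_passage_bound:
  assumes N: "\<And>x. x \<ge> xa \<Longrightarrow> of_real x \<in> N" and e: "e > 0" and dl: "d > 0" "l > 0" and C: "C > 0"
    and slope: "\<And>x. x \<ge> xa \<Longrightarrow> e * cmod (q (F (of_real x))) \<le> Re (q (F (of_real x)))"
    and unit: "cmod b = 1"
    and disc1: "ball (of_real xa + of_real l * b) (l + d) \<subseteq> N"
    and disc2: "ball (of_real (xa + l / 2) + of_real l * b) (l + d) \<subseteq> N"
    and barrier: "\<And>x. xa \<le> x \<Longrightarrow> x \<le> xa + l / 2 \<Longrightarrow> \<exists>w. w \<notin> N \<and> cmod (w - of_real x) \<le> C * d"
  shows "exp (e * l / (12 * C * d)) \<le> 3 * (2 * l / d + 1)\<^sup>2"
proof -
  define U where "U x = Re (F (of_real x))" for x :: real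
  define c1 c2 where "c1 = of_real xa + of_real l * b" and "c2 = of_real (xa + l / 2) + of_real l * b"
  have Up: "U x > 0" if "x \<ge> xa" for x using N[OF that] by (simp add: U_def)
  have grow: "ln (U xa) - e / (6 * C * d) * xa \<le> ln (U (xa + l / 2)) - e / (6 * C * d) * (xa + l / 2)"
  proof (rule DERIV_nonneg_imp_nondecreasing[where f = "\<lambda>x. ln (U x) - e / (6 * C * d) * x"])
    fix y assume y: "xa \<le> y" "y \<le> xa + l / 2"
    define a where "a = q (F (of_real y))"
    have yN: "0 + of_real y \<in> N" using N[OF y(1)] by simp
    have a: "cmod a > 0" using q_nonzero[of "F (of_real y)"] N[OF y(1)] by (simp add: a_def)
    have U: "U y > 0" using Up y by simp
    have der: "((\<lambda>x. ln (U x) - e / (6 * C * d) * x) has_real_derivative Re (1 / a) / U y - e / (6 * C * d)) (at y)"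
    proof -
      have dU: "(U has_real_derivative Re (1 / a)) (at y)"
        using Re_F_shift_deriv[OF yN] by (simp add: U_def[abs_def] a_def)
      have "((\<lambda>x. ln (U x)) has_real_derivative 1 / U y * Re (1 / a)) (at y)"
        using DERIV_chain2[OF DERIV_ln_divide[OF U] dU] by simp
      from DERIV_diff[OF this DERIV_cmult_Id[of "e / (6 * C * d)"]] show ?thesis
        by (simp only: times_divide_eq_left mult_1_left)
    qed
    obtain w where w: "w \<notin> N" "cmod (w - of_real y) \<le> C * d" using barrier[OF y] by blast
    have "w \<notin> cball (of_real y) (U y * cmod a / 6)"
      using covers_ball[of "F (of_real y)"] w(1) N[OF y(1)] by (auto simp: U_def a_def)
    then have "U y * cmod a \<le> 6 * C * d" using w(2) by (simp add: dist_norm norm_minus_commute)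
    then have "e * (U y * cmod a) \<le> e * (6 * C * d)" using e by (intro mult_left_mono) auto
    then have "e / (6 * C * d) \<le> e / (U y * cmod a)"
      using U a C dl e by (intro divide_left_mono) (auto intro: mult_pos_pos simp: mult_ac)
    also have "\<dots> = e * cmod a / (cmod a)\<^sup>2 / U y" using a by (simp add: power2_eq_square)
    also have "\<dots> \<le> Re a / (cmod a)\<^sup>2 / U y"
      using slope[OF y(1)] U by (intro divide_right_mono) (auto simp: a_def)
    also have "\<dots> = Re (1 / a) / U y" by (simp add: Re_divide cmod_power2)
    finally show "\<exists>D. ((\<lambda>x. ln (U x) - e / (6 * C * d) * x) has_real_derivative D) (at y) \<and> 0 \<le> D"
      using der by auto
  qed (use dl in auto)
  have h1: "Re (F c1) * d \<le> U xa * (2 * l + d)"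
  proof -
    have "cmod (of_real xa - c1) = l" using dl unit by (simp add: c1_def norm_mult)
    then show ?thesis
      using Re_F_harnack(2)[OF disc1[folded c1_def], of "of_real xa"] dl
      by (simp add: U_def dist_norm norm_minus_commute)
  qed
  have h2: "U (xa + l / 2) * d \<le> Re (F c2) * (2 * l + d)"
  proof -
    have "cmod (of_real (xa + l / 2) - c2) = l" using dl unit by (simp add: c2_def norm_mult)
    then show ?thesis
      using Re_F_harnack(1)[OF disc2[folded c2_def], of "of_real (xa + l / 2)"] dl
      by (simp add: U_def dist_norm norm_minus_commute)
  qed
  have c2N: "c2 \<in> N" using disc2 dl by (auto simp: c2_def)
  have h3: "Re (F c2) \<le> 3 * Re (F c1)"
  proof -
    have "c2 - c1 = of_real (l / 2)" by (simp add: c1_def c2_def)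
    then have n: "cmod (c2 - c1) = l / 2" using dl by (metis norm_of_real abs_of_pos half_gt_zero)
    have "c2 \<in> ball c1 (l + d)" using n dl by (simp add: dist_norm norm_minus_commute)
    from Re_F_harnack(1)[OF disc1[folded c1_def] this]
    have "Re (F c2) * (l / 2 + d) \<le> Re (F c1) * (3 * l / 2 + d)"
      unfolding n by (simp add: algebra_simps)
    also have "\<dots> \<le> Re (F c1) * (3 * (l / 2 + d))"
      using disc1 dl by (intro mult_left_mono less_imp_le[OF Re_F_pos]) (auto simp: c1_def)
    finally have "Re (F c2) * (l / 2 + d) \<le> 3 * Re (F c1) * (l / 2 + d)" by (simp only: mult.assoc mult.left_commute)
    then show ?thesis using dl by (simp add: mult_le_cancel_right)
  qed
  define m where "m = 2 * l / d + 1"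
  have m: "m > 0" "2 * l + d = m * d" using dl by (auto simp: m_def field_simps)
  have "U (xa + l / 2) \<le> Re (F c2) * m" using h2 dl by (simp add: m)
  also have "\<dots> \<le> 3 * Re (F c1) * m" using h3 m by (intro mult_right_mono) auto
  also have "\<dots> \<le> 3 * (U xa * m) * m" using h1 dl m(1) by (intro mult_right_mono) (auto simp: m(2))
  finally have ub: "U (xa + l / 2) \<le> U xa * (3 * m\<^sup>2)" by (simp add: power2_eq_square mult_ac)
  have "e / (6 * C * d) * (l / 2) \<le> ln (U (xa + l / 2)) - ln (U xa)"
    using grow unfolding distrib_left by linarith
  also have "\<dots> = ln (U (xa + l / 2) / U xa)"
    using Up[of xa] Up[of "xa + l / 2"] dl by (simp add: ln_div)
  finally have "exp (e / (6 * C * d) * (l / 2)) \<le> U (xa + l / 2) / U xa"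
    using Up[of xa] Up[of "xa + l / 2"] dl by (simp add: ln_ge_iff)
  also have "\<dots> \<le> 3 * m\<^sup>2" using ub Up[of xa] by (simp add: field_simps)
  finally show ?thesis by (simp add: m_def mult_ac)
qed

end

section \<open>Angular extents\<close>

text \<open>The sign \<open>k = 1\<close> selects the arc running upwards from \<open>t\<close>, \<open>k = - 1\<close> the arc running downwards.
  These correspond to the left and right extents before the rotation by \<open>- \<i>\<close>.\<close>

definition arc_extent :: "complex set \<Rightarrow> real \<Rightarrow> real \<Rightarrow> real" where
  "arc_extent A k t = real_of_ereal (min (ereal pi) (Sup (ereal ` {\<alpha>. \<alpha> > 0 \<and>
     (\<forall>\<theta>\<in>{0..\<alpha>}. of_real t * cis (k * \<theta>) \<in> A)})))"

text \<open>The truncated supremum is an honest first exit time: before it the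
  parameter is in \<open>S\<close>, and if it is not truncated, then it is outside \<open>S\<close> because \<open>S\<close> is open.\<close>

lemma first_exit_parameter:
  fixes S :: "real set"
  assumes "open S" "0 \<in> S" "b > 0"
  defines "e \<equiv> real_of_ereal (min (ereal b) (Sup (ereal ` {\<alpha>. \<alpha> > 0 \<and> (\<forall>\<theta>\<in>{0..\<alpha>}. \<theta> \<in> S)})))"
  shows "0 < e" "e \<le> b" "\<And>\<theta>. 0 \<le> \<theta> \<Longrightarrow> \<theta> < e \<Longrightarrow> \<theta> \<in> S" "e < b \<Longrightarrow> e \<notin> S"
proof -
  define T L where "T = {\<alpha>. \<alpha> > 0 \<and> (\<forall>\<theta>\<in>{0..\<alpha>}. \<theta> \<in> S)}" and "L = Sup (ereal ` T)"
  have room: "\<exists>d>0. \<forall>\<theta>. \<bar>\<theta> - x\<bar> \<le> d \<longrightarrow> \<theta> \<in> S" if "x \<in> S" for x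
    using open_contains_cball[of S] \<open>open S\<close> that by (force simp: subset_iff dist_real_def abs_minus_commute)
  obtain d where "d > 0" "\<And>\<theta>. \<bar>\<theta> - 0\<bar> \<le> d \<Longrightarrow> \<theta> \<in> S" using room[OF \<open>0 \<in> S\<close>] by blast
  then have "d \<in> T" by (auto simp: T_def)
  then have "ereal d \<le> L" unfolding L_def by (intro Sup_upper imageI)
  then have Lpos: "L > 0" using \<open>d > 0\<close> by (metis ereal_less(2) less_le_trans)
  have e: "ereal e = min (ereal b) L"
    unfolding e_def T_def[symmetric] L_def[symmetric]
    using Lpos \<open>b > 0\<close> by (cases L) (auto simp: min_def)
  show "0 < e" using e Lpos \<open>b > 0\<close> by (metis ereal_less(2) min_less_iff_conj)
  show "e \<le> b" using e by (metis ereal_less_eq(3) min.cobounded1)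
  show "\<theta> \<in> S" if "0 \<le> \<theta>" "\<theta> < e" for \<theta>
  proof -
    have "ereal \<theta> < L" using e that by (metis ereal_less(3) less_ereal.simps(1) min_less_iff_conj)
    then obtain \<alpha> where "\<alpha> \<in> T" "\<theta> < \<alpha>" by (auto simp: L_def less_Sup_iff)
    then show ?thesis using that by (auto simp: T_def)
  qed
  note before = this
  show "e \<notin> S" if "e < b"
  proof
    assume "e \<in> S"
    then obtain d where d: "d > 0" "\<And>\<theta>. \<bar>\<theta> - e\<bar> \<le> d \<Longrightarrow> \<theta> \<in> S" using room by blast
    have "\<theta> \<in> S" if "0 \<le> \<theta>" "\<theta> \<le> e + d" for \<theta>
      using before[of \<theta>] d(2)[of \<theta>] that by (cases "\<theta> < e") auto
    then have "e + d \<in> T" using \<open>0 < e\<close> d(1) by (auto simp: T_def)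
    then have "ereal (e + d) \<le> L" unfolding L_def by (intro Sup_upper imageI)
    moreover have "L = ereal e" using e that by (auto simp: min_def split: if_splits)
    ultimately show False using d(1) by simp
  qed
qed

lemma arc_extent_props:
  assumes "open A" "of_real t \<in> A"
  shows "0 < arc_extent A k t" "arc_extent A k t \<le> pi"
    "\<And>\<theta>. 0 \<le> \<theta> \<Longrightarrow> \<theta> < arc_extent A k t \<Longrightarrow> of_real t * cis (k * \<theta>) \<in> A"
    "arc_extent A k t < pi \<Longrightarrow> of_real t * cis (k * arc_extent A k t) \<notin> A"
proof -
  define S where "S = {\<theta>. of_real t * cis (k * \<theta>) \<in> A}"
  have S: "open S"
  proof -
    have "continuous_on UNIV (\<lambda>\<theta>. complex_of_real t * cis (k * \<theta>))"
      unfolding cis_conv_exp by (intro continuous_intros)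
    from open_vimage[OF \<open>open A\<close> this] show ?thesis by (simp only: S_def vimage_def)
  qed
  have S0: "0 \<in> S" using assms by (simp add: S_def)
  have memS: "of_real t * cis (k * \<theta>) \<in> A \<longleftrightarrow> \<theta> \<in> S" for \<theta>
    by (simp only: S_def mem_Collect_eq)
  note exits = first_exit_parameter[OF S S0 pi_gt_zero]
  show "0 < arc_extent A k t" "arc_extent A k t \<le> pi"
    unfolding arc_extent_def memS by (rule exits)+
  show "of_real t * cis (k * \<theta>) \<in> A" if "0 \<le> \<theta>" "\<theta> < arc_extent A k t" for \<theta>
    using that unfolding arc_extent_def memS by (rule exits)
  show "of_real t * cis (k * arc_extent A k t) \<notin> A" if "arc_extent A k t < pi"
    using that unfolding arc_extent_def memS by (rule exits)
qed

lemma arcsin_le_twice: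
  assumes "0 \<le> y" "y \<le> 1 / 2"
  shows "arcsin y \<le> 2 * y"
proof -
  have "y\<^sup>2 \<le> (1 / 2)\<^sup>2" using assms by (intro power_mono) auto
  then have "(1 / 2)\<^sup>2 \<le> 1 - y\<^sup>2" by (simp add: power2_eq_square)
  then have s: "1 / 2 \<le> sqrt (1 - y\<^sup>2)" by (rule real_le_rsqrt)
  have "arcsin y = arctan (y / sqrt (1 - y\<^sup>2))"
    using assms by (intro arcsin_arctan) auto
  also have "\<dots> \<le> y / sqrt (1 - y\<^sup>2)"
  proof (intro arctan_le_self divide_nonneg_nonneg)
    show "sqrt (1 - y\<^sup>2) \<ge> 0" using s by linarith
  qed (use assms in simp)
  also have "\<dots> \<le> y / (1 / 2)"
  proof (rule divide_left_mono[OF s assms(1)])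
    show "0 < sqrt (1 - y\<^sup>2) * (1 / 2)" using s by linarith
  qed
  finally show ?thesis by simp
qed

lemma cmod_cis_minus_one_le: "cmod (cis x - 1) \<le> \<bar>x\<bar>"
proof -
  have "cmod (cis x - 1)^2 = 2 * (1 - cos x)"
    by (simp add: cmod_power2 power2_diff algebra_simps)
  also have "\<dots> = (2 * sin (x / 2))\<^sup>2" using cos_double_sin[of "x / 2"] by (simp add: power_mult_distrib)
  also have "\<dots> \<le> \<bar>x\<bar>\<^sup>2"
    using abs_sin_x_le_abs_x[of "x / 2"] by (subst abs_le_square_iff[symmetric]) (simp add: abs_mult)
  finally show ?thesis by (rule power2_le_imp_le) simp
qed

text \<open>The witness comes from \<open>exp (s x) \<ge> (s x / 3) ^ 3\<close> and \<open>3 (2 x + 1)\<^sup>2 \<le> 27 x\<^sup>2\<close> for \<open>x \<ge> 1\<close>.\<close>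

lemma exp_beats_square:
  fixes s :: real
  assumes "s > 0"
  shows "\<exists>x\<ge>1. exp (s * x) > 3 * (2 * x + 1)\<^sup>2"
proof -
  define x where "x = 1 + 729 / s ^ 3"
  have x: "x \<ge> 1" using assms by (simp add: x_def)
  have "3 * (2 * x + 1)\<^sup>2 \<le> 3 * (3 * x)\<^sup>2" using x by (intro mult_left_mono power_mono) auto
  also have "\<dots> = 27 * x\<^sup>2" by (simp add: power2_eq_square)
  also have "\<dots> < (s ^ 3 * x / 27) * x\<^sup>2"
  proof (rule mult_strict_right_mono)
    have "s ^ 3 * x = s ^ 3 + 729" using assms by (simp add: x_def field_simps)
    then show "27 < s ^ 3 * x / 27" using assms by simp
  qed (use x in simp)
  also have "\<dots> = (s * x / 3) ^ 3" by (simp add: power_mult_distrib power_divide power2_eq_square power3_eq_cube)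
  also have "\<dots> \<le> exp (s * x / 3) ^ 3"
  proof (rule power_mono)
    show "s * x / 3 \<le> exp (s * x / 3)" using exp_ge_add_one_self[of "s * x / 3"] by linarith
  qed (use assms x in simp)
  also have "\<dots> = exp (s * x)" using exp_of_nat_mult[of 3 "s * x / 3"] by simp
  finally show ?thesis using x by blast
qed

context halfplane_koenigs
begin

abbreviation extent :: "real \<Rightarrow> real \<Rightarrow> real" where
  "extent \<equiv> arc_extent N"

lemma not_in_N_left: "w \<notin> N \<Longrightarrow> s \<ge> 0 \<Longrightarrow> w - of_real s \<notin> N"
  using shift_N[of "w - of_real s" s] by auto

lemma barrier_transport:
  assumes "w \<notin> N" "x \<le> Re w"
  shows "Complex x (Im w) \<notin> N"
proof -
  have "Complex x (Im w) = w - of_real (Re w - x)" by (simp add: complex_eq_iff)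
  then show ?thesis using not_in_N_left[OF assms(1), of "Re w - x"] assms(2) by simp
qed

text \<open>A point \<open>w\<close> this close to the real axis lies to the right of the point of the circle of radius
  \<open>t / 2\<close> with the same imaginary part.  The angle of the latter has sine \<open>y = 2 \<bar>Im w\<bar> / t\<close>, hence is at most \<open>2 y\<close>, which is less than
  the extent at \<open>t / 2\<close> by the doubling hypothesis; so that point is in \<open>N\<close>, and \<open>w\<close> is a
  translate of it.\<close>

lemma half_strip_side:
  assumes t: "t > 0" and N: "\<And>x. x \<ge> t / 2 \<Longrightarrow> of_real x \<in> N"
    and c: "0 < c" "c \<le> 1 / 4" "c * extent k t \<le> extent k (t / 2)" and k: "\<bar>k\<bar> = 1"
    and w: "Re w \<ge> t / 2" "0 \<le> k * Im w" "k * Im w < c / 5 * t * extent k t"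
  shows "w \<in> N"
proof -
  define y where "y = 2 * (k * Im w) / t"
  have y0: "y \<ge> 0" using w t by (simp add: y_def)
  have e: "extent k t \<le> pi" using arc_extent_props(2)[OF open_N N] t by simp
  have y1: "y < 2 * (c * extent k t) / 5" using w(3) t by (simp add: y_def field_simps)
  have "c * extent k t \<le> 1 / 4 * 4"
    using c e pi_less_4 arc_extent_props(1)[OF open_N N, of t k] t by (intro mult_mono) auto
  then have y2: "y \<le> 1 / 2" using y1 by simp
  have "arcsin y \<le> 2 * y" using y0 y2 by (rule arcsin_le_twice)
  also have "\<dots> < extent k (t / 2)"
    using y1 c(3) arc_extent_props(1)[OF open_N N, of "t / 2" k] by simp
  finally have "of_real (t / 2) * cis (k * arcsin y) \<in> N"
    using y0 y2 arc_extent_props(3)[OF open_N N, of "t / 2" "arcsin y" k] arcsin_bounded[of y]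
    by (simp add: arcsin_nonneg)
  moreover define s where "s = Re w - t / 2 * cos (k * arcsin y)"
  moreover have "t / 2 * cos (k * arcsin y) \<le> t / 2" using t by simp
  ultimately have "of_real (t / 2) * cis (k * arcsin y) + of_real s \<in> N"
    using w(1) by (intro shift_N) auto
  also have "of_real (t / 2) * cis (k * arcsin y) + of_real s = w"
  proof -
    have "sin (k * arcsin y) = k * y"
      using k y0 y2 by (cases "k = 1") (auto simp: abs_if split: if_splits)
    moreover have "k * k = 1" using k by (auto simp: abs_if split: if_splits)
    ultimately show ?thesis
      using t by (simp add: complex_eq_iff s_def y_def flip: mult.assoc)
  qed
  finally show ?thesis .
qed

lemma half_strip:
  assumes t: "t > 0" and N: "\<And>x. x \<ge> t / 2 \<Longrightarrow> of_real x \<in> N"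
    and c: "0 < c" "c \<le> 1 / 4" "\<And>k. \<bar>k\<bar> = 1 \<Longrightarrow> c * extent k t \<le> extent k (t / 2)"
    and w: "Re w \<ge> t / 2" "\<And>k. \<bar>k\<bar> = 1 \<Longrightarrow> k * Im w < c / 5 * t * extent k t"
  shows "w \<in> N"
proof -
  define k where "k = (if Im w \<ge> 0 then 1 else - 1 :: real)"
  have k: "\<bar>k\<bar> = 1" "0 \<le> k * Im w" by (auto simp: k_def)
  show ?thesis by (rule half_strip_side[OF t N c(1,2) c(3)[OF k(1)] k(1) w(1) k(2) w(2)[OF k(1)]])
qed

text \<open>A Liouville argument: arbitrarily large discs in \<open>N\<close> about \<open>0\<close> would contradict Schwarz-Pick.\<close>

lemma N_ne_UNIV: "\<exists>w. w \<notin> N"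
proof (rule ccontr)
  assume "\<not> ?thesis"
  then have all: "ball 0 (2 * Re (F 0) * cmod (q (F 0)) + 1) \<subseteq> N" "0 \<in> N" by auto
  have "2 * Re (F 0) * cmod (q (F 0)) + 1 > 0"
    using Re_F_pos[OF all(2)] by (intro add_nonneg_pos) auto
  from inner_radius_bound[OF all(1) this] show False by simp
qed

text \<open>Suppose that the extent on side \<open>k\<close> at radius \<open>t\<close> is much smaller than that on side \<open>- k\<close>.  By
  the doubling hypothesis it is still small at radius \<open>2 t\<close>.  The left ray from the exit point
  there supplies barriers for the passage from \<open>t\<close> to \<open>t + l d / 2\<close>, where \<open>d\<close> is the
  height of the half-strip on side \<open>k\<close>.  The half-strip on side \<open>- k\<close> has room for discs of radius
  \<open>l d\<close>, and \<open>l\<close> is chosen so large that \<open>narrow_passage_bound\<close> fails.\<close>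

lemma extents_comparable_if_slope:
  assumes N: "\<And>x. x \<ge> x1 \<Longrightarrow> of_real x \<in> N" and e: "e > 0"
    and slope: "\<And>x. x \<ge> x1 \<Longrightarrow> e * cmod (q (F (of_real x))) \<le> Re (q (F (of_real x)))"
    and c: "0 < c" "c \<le> 1 / 4" "\<And>k t. \<bar>k\<bar> = 1 \<Longrightarrow> t \<ge> T \<Longrightarrow> c * extent k t \<le> extent k (t / 2)"
    and k: "\<bar>k\<bar> = 1"
  shows "\<exists>L>0. \<exists>T'. \<forall>t\<ge>T'. extent (- k) t \<le> L * extent k t"
proof -
  define C where "C = 10 / c\<^sup>2"
  have C: "C > 0" using c by (simp add: C_def)
  obtain l where l: "l \<ge> 1" "exp (e / (12 * C) * l) > 3 * (2 * l + 1)\<^sup>2"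
    using exp_beats_square[of "e / (12 * C)"] e C by auto
  define L where "L = max (2 * l + 1) (16 / c)"
  have L: "L \<ge> 2 * l + 1" "L * c \<ge> 16" "L > 0"
  proof -
    show "L \<ge> 2 * l + 1" by (simp add: L_def)
    then show "L > 0" using l by simp
    have "16 / c \<le> L" by (simp add: L_def)
    then show "L * c \<ge> 16" using c by (simp add: field_simps)
  qed
  have "extent (- k) t \<le> L * extent k t" if t: "t \<ge> max T (max 1 (2 * x1))" for t
  proof (rule ccontr)
    define a b d where "a = extent k t" and "b = extent (- k) t" and "d = c / 5 * t * a"
    assume "\<not> ?thesis"
    then have ab: "L * a < b" by (simp add: a_def b_def)
    have tp: "t > 0" "t \<ge> x1" "t \<ge> T" "t \<ge> 2 * x1" using t by auto
    have inN: "of_real x \<in> N" if "x \<ge> t / 2" for x using N[of x] that tp by simp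
    have a0: "a > 0" using arc_extent_props(1)[OF open_N inN] tp by (simp add: a_def)
    have bpi: "b \<le> pi" using arc_extent_props(2)[OF open_N inN] tp by (simp add: b_def)
    have d0: "d > 0" using a0 c tp by (simp add: d_def)
    have wide: "(2 * l + 1) * d < c / 5 * t * b"
    proof -
      have "(2 * l + 1) * a \<le> L * a" using L a0 by (intro mult_right_mono) auto
      then have "(2 * l + 1) * a < b" using ab by simp
      then have "c / 5 * t * ((2 * l + 1) * a) < c / 5 * t * b" using c tp by (intro mult_strict_left_mono) auto
      then show ?thesis by (simp add: d_def mult_ac)
    qed
    have "c / 5 * t * b \<le> c / 5 * t * 4" using bpi pi_less_4 c tp by (intro mult_left_mono) auto
    also have "\<dots> \<le> t / 4" using c tp by simp
    finally have short: "(2 * l + 1) * d < t / 4" using wide by simp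
    have ld: "l * d \<ge> d" using l d0 by simp
    have small: "l * d + d \<le> t / 4" "l * d / 2 \<le> t / 4"
    proof -
      have "2 * (l * d) + d < t / 4" using short by (simp add: algebra_simps)
      then show "l * d + d \<le> t / 4" "l * d / 2 \<le> t / 4" using ld d0 by linarith+
    qed
    \<comment> \<open>The arc of radius \<open>2 t\<close> ends beyond the whole passage, so its exit point shields all of it.\<close>
    define a2 where "a2 = extent k (2 * t)"
    have in2: "of_real (2 * t) \<in> N" using tp by (intro inN) simp
    have a2: "c * a2 \<le> a" using c(3)[OF k, of "2 * t"] tp by (simp add: a_def a2_def)
    have a20: "a2 > 0" using arc_extent_props(1)[OF open_N in2] by (simp add: a2_def)
    have a2s: "a2 \<le> 1 / 4"
    proof -
      have "16 * a2 \<le> (L * c) * a2" using L a20 by (intro mult_right_mono) auto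
      also have "\<dots> \<le> L * a" using a2 L by simp
      also have "\<dots> \<le> 4" using ab bpi pi_less_4 by simp
      finally show ?thesis by simp
    qed
    define w where "w = of_real (2 * t) * cis (k * a2)"
    have "w \<notin> N"
      using arc_extent_props(4)[OF open_N in2, of k] a2s pi_gt3 by (simp add: w_def a2_def)
    have dist: "cmod (cis (k * a2) - 1) \<le> a2"
      using cmod_cis_minus_one_le[of "k * a2"] k a20 by (simp add: abs_mult)
    have "w - of_real (2 * t) = of_real (2 * t) * (cis (k * a2) - 1)" by (simp add: w_def algebra_simps)
    then have "cmod (w - of_real (2 * t)) = 2 * t * cmod (cis (k * a2) - 1)"
      using tp by (simp add: norm_mult)
    also have "\<dots> \<le> 2 * t * a2" using dist tp by (intro mult_left_mono) auto
    finally have wd: "cmod (w - of_real (2 * t)) \<le> 2 * t * a2" .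
    have "2 * t * a2 \<le> 2 * t * (1 / 4)" using a2s tp by (intro mult_left_mono) auto
    then have Rew: "Re w \<ge> 3 / 2 * t" 
      using wd abs_Re_le_cmod[of "w - of_real (2 * t)"] by (simp add: abs_le_iff)
    have "\<bar>Im w\<bar> \<le> 2 * t * a2" using wd abs_Im_le_cmod[of "w - of_real (2 * t)"] by simp
    also have "\<dots> \<le> C * d"
    proof -
      have "2 * t * (c * a2) \<le> 2 * t * a" using a2 tp by (intro mult_left_mono) auto
      then show ?thesis using c by (simp add: C_def d_def power2_eq_square field_simps)
    qed
    finally have Imw: "\<bar>Im w\<bar> \<le> C * d" .
    have "exp (e * (l * d) / (12 * C * d)) \<le> 3 * (2 * (l * d) / d + 1)\<^sup>2"
    proof (rule narrow_passage_bound[where xa = t and b = "\<i> * of_real (- k)"])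
      have disc: "ball (of_real x + of_real (l * d) * (\<i> * of_real (- k))) (l * d + d) \<subseteq> N" if x: "x \<ge> t" for x
      proof
        fix v assume "v \<in> ball (of_real x + of_real (l * d) * (\<i> * of_real (- k))) (l * d + d)"
        then have vd: "cmod (v - (of_real x + of_real (l * d) * (\<i> * of_real (- k)))) < l * d + d"
          by (simp add: dist_norm norm_minus_commute)
        have Rev: "\<bar>Re v - x\<bar> < l * d + d" and Imv: "\<bar>Im v + l * d * k\<bar> < l * d + d"
          using le_less_trans[OF abs_Re_le_cmod vd] le_less_trans[OF abs_Im_le_cmod vd] by simp_all
        have kk: "k = 1 \<or> k = - 1" using k by (auto simp: abs_if split: if_splits)
        have "k * Im v < d" "- k * Im v < (2 * l + 1) * d"
          using kk Imv by (auto simp: abs_less_iff algebra_simps)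
        then have sides: "k * Im v < c / 5 * t * extent k t" "- k * Im v < c / 5 * t * extent (- k) t"
          using wide unfolding a_def[symmetric] b_def[symmetric] d_def[symmetric] by simp_all
        then have side: "k' * Im v < c / 5 * t * extent k' t" if "\<bar>k'\<bar> = 1" for k'
        proof -
          have "k' = k \<or> k' = - k" using kk that by (auto simp: abs_if split: if_splits)
          then show ?thesis using sides by blast
        qed
        show "v \<in> N"
        proof (rule half_strip[OF tp(1) inN c(1,2)])
          show "c * extent k' t \<le> extent k' (t / 2)" if "\<bar>k'\<bar> = 1" for k' using that tp(3) by (rule c(3))
          show "Re v \<ge> t / 2" using Rev small(1) x tp(1) by linarith
        qed (use side in auto)
      qed
      show "ball (of_real t + of_real (l * d) * (\<i> * of_real (- k))) (l * d + d) \<subseteq> N"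
        by (rule disc) simp
      show "ball (of_real (t + l * d / 2) + of_real (l * d) * (\<i> * of_real (- k))) (l * d + d) \<subseteq> N"
        by (rule disc) (use l d0 in simp)
      show "\<exists>w. w \<notin> N \<and> cmod (w - of_real x) \<le> C * d" if "t \<le> x" "x \<le> t + l * d / 2" for x
      proof -
        have "Complex x (Im w) \<notin> N"
        proof (rule barrier_transport[OF \<open>w \<notin> N\<close>])
          show "x \<le> Re w" using that(2) small(2) Rew tp(1) by linarith
        qed
        moreover have "Complex x (Im w) - of_real x = \<i> * of_real (Im w)" by (simp add: complex_eq_iff)
        then have "cmod (Complex x (Im w) - of_real x) \<le> C * d" using Imw by (simp add: norm_mult)
        ultimately show ?thesis by blast
      qed
      show "of_real x \<in> N" if "x \<ge> t" for x using N[of x] that tp by simp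
      show "e * cmod (q (F (of_real x))) \<le> Re (q (F (of_real x)))" if "x \<ge> t" for x
        by (rule slope) (use that tp in simp)
      show "cmod (\<i> * of_real (- k)) = 1" using k by (simp add: norm_mult)
      show "l * d > 0" using l d0 by simp
    qed (fact e d0 C)+
    moreover have "e * (l * d) / (12 * C * d) = e / (12 * C) * l" "2 * (l * d) / d = 2 * l"
      using d0 by simp_all
    ultimately show False using l(2) by simp
  qed
  with L(3) show ?thesis by (intro exI[of _ L] exI[of _ "max T (max 1 (2 * x1))"] conjI allI impI)
qed

text \<open>The disc about \<open>t\<close> comes from the half-strips.  If the arc on side \<open>k\<close> leaves \<open>N\<close>, its exit
  point is the barrier on that side.  If it does not, then the extent is \<open>pi\<close>, the radius of the disc is
  comparable to \<open>t\<close>, and a point with real part \<open>- t\<close> on the left ray from any fixed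
  \<open>w0 \<notin> N\<close> is near enough to the axis to serve both sides.\<close>

lemma slope_if_extents_comparable:
  assumes N: "\<And>x. x \<ge> x1 \<Longrightarrow> of_real x \<in> N"
    and c: "0 < c" "c \<le> 1 / 4" "\<And>k t. \<bar>k\<bar> = 1 \<Longrightarrow> t \<ge> T \<Longrightarrow> c * extent k t \<le> extent k (t / 2)"
    and L: "L \<ge> 1" "\<And>k t. \<bar>k\<bar> = 1 \<Longrightarrow> t \<ge> T \<Longrightarrow> extent k t \<le> L * extent (- k) t"
  shows "\<exists>e>0. \<exists>T'. \<forall>x\<ge>T'. e * cmod (q (F (of_real x))) \<le> Re (q (F (of_real x)))"
proof -
  define \<kappa> C where "\<kappa> = c / 5" and "C = L / \<kappa>"
  have kap: "\<kappa> > 0" using c by (simp add: \<kappa>_def)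
  have C: "C > 0" using kap L by (simp add: C_def)
  obtain w0 where w0: "w0 \<notin> N" using N_ne_UNIV by blast
  define I where "I = 8 * \<bar>Im w0\<bar> * L / \<kappa>"
  have I: "I \<ge> 0" using kap L by (simp add: I_def)
  \<comment> \<open>\<open>I\<close> makes the height of \<open>w0\<close> negligible against the radius of the disc.\<close>
  define T' where "T' = 1 + \<bar>T\<bar> + 2 * \<bar>x1\<bar> + \<bar>Re w0\<bar> + \<bar>Im w0\<bar> + I"
  have "eta (2 * C + 1) * cmod (q (F (of_real t))) \<le> Re (q (F (of_real t)))" if t: "t \<ge> T'" for t
  proof -
    have tp: "t \<ge> 1" "t \<ge> T" "t \<ge> 2 * x1" "t \<ge> \<bar>Re w0\<bar>" "t \<ge> \<bar>Im w0\<bar>" "t \<ge> I"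
      using t I unfolding T'_def by linarith+
    have inN: "of_real x \<in> N" if "x \<ge> t / 2" for x using N[of x] that tp by simp
    define m R where "m = min (extent 1 t) (extent (- 1) t)" and "R = \<kappa> * t * m"
    have extent: "0 < extent k t" "extent k t \<le> pi" for k
      using arc_extent_props(1,2)[OF open_N inN] tp by auto
    have m: "m > 0" using extent by (simp add: m_def)
    have R: "R > 0" using m kap tp by (simp add: R_def)
    have ext_m: "m \<le> extent k t" "extent k t \<le> L * m" if k: "\<bar>k\<bar> = 1" for k
    proof -
      have k': "k = 1 \<or> k = - 1" using k by (auto simp: abs_if split: if_splits)
      then show "m \<le> extent k t" by (auto simp: m_def)
      have "extent k t \<le> L * extent k t" using L(1) extent[of k] by simp
      then show "extent k t \<le> L * m" using L(2)[OF k tp(2)] k' by (auto simp: m_def min_def)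
    qed
    have "ball (complex_of_real t) R \<subseteq> N"
    proof
      fix w :: complex assume w: "w \<in> ball (of_real t) R"
      then have wd: "cmod (w - of_real t) < R" by (simp add: dist_norm norm_minus_commute)
      have "R \<le> t / 2"
      proof -
        have "R \<le> (1 / 4 / 5) * t * pi"
          unfolding R_def \<kappa>_def using c tp m extent(2)[of 1] ext_m(1)[of 1] by (intro mult_mono) auto
        also have "\<dots> \<le> (1 / 4 / 5) * t * 4" using pi_less_4 tp by (intro mult_left_mono) auto
        finally show ?thesis using tp by simp
      qed
      then have "Re w \<ge> t / 2" using wd abs_Re_le_cmod[of "w - of_real t"] by simp
      moreover have "k * Im w < c / 5 * t * extent k t" if k: "\<bar>k\<bar> = 1" for k
      proof -
        have "k * Im w \<le> \<bar>k * Im w\<bar>" by simp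
        also have "\<dots> < R" using wd abs_Im_le_cmod[of "w - of_real t"] k by (simp add: abs_mult)
        also have "R \<le> \<kappa> * t * extent k t" unfolding R_def using ext_m(1)[OF k] kap tp by (intro mult_left_mono) auto
        finally show ?thesis by (simp add: \<kappa>_def)
      qed
      ultimately show "w \<in> N"
      proof (intro half_strip[OF _ inN c(1,2)])
        show "c * extent k t \<le> extent k (t / 2)" if "\<bar>k\<bar> = 1" for k using that tp(2) by (rule c(3))
      qed (use tp in auto)
    qed
    moreover have "\<exists>w. w \<notin> N \<and> cmod (w - complex_of_real t) \<le> C * R \<and> k * Im w \<ge> - R / 8" if k: "\<bar>k\<bar> = 1" for k
    proof -
      have "t * extent k t \<le> t * (L * m)" using ext_m(2)[OF k] tp by (intro mult_left_mono) auto
      also have "\<dots> = C * R" using kap by (simp add: C_def R_def)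
      finally have CR: "t * extent k t \<le> C * R" .
      show ?thesis
      proof (cases "extent k t < pi")
        case True
        define w where "w = of_real t * cis (k * extent k t)"
        have "w \<notin> N" using arc_extent_props(4)[OF open_N inN, of t k] True tp by (simp add: w_def)
        moreover have "cmod (w - of_real t) \<le> C * R"
        proof -
          have "w - of_real t = of_real t * (cis (k * extent k t) - 1)" by (simp add: w_def algebra_simps)
          then have "cmod (w - of_real t) = t * cmod (cis (k * extent k t) - 1)" using tp by (simp add: norm_mult)
          also have "\<dots> \<le> t * \<bar>k * extent k t\<bar>" using tp by (intro mult_left_mono cmod_cis_minus_one_le) auto
          also have "\<dots> = t * extent k t" using k extent[of k] by (simp add: abs_mult)
          finally show ?thesis using CR by simp
        qed
        moreover have "k * Im w \<ge> 0"
        proof -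
          have "k = 1 \<or> k = -1" using k by (auto simp: abs_if split: if_splits)
          then have "k * Im w = t * sin (extent k t)" by (auto simp: w_def)
          then show ?thesis using tp extent[of k] sin_ge_zero[of "extent k t"] by simp
        qed
        ultimately show ?thesis using R by (intro exI[of _ w]) auto
      next
        case False
        then have epi: "extent k t = pi" using extent(2)[of k] by simp
        define w where "w = Complex (- t) (Im w0)"
        have "w \<notin> N" unfolding w_def using w0 tp by (intro barrier_transport) auto
        moreover have "cmod (w - of_real t) \<le> C * R"
        proof -
          have "cmod (w - of_real t) \<le> \<bar>Re (w - of_real t)\<bar> + \<bar>Im (w - of_real t)\<bar>" by (rule cmod_le)
          also have "\<dots> \<le> t * 3" using tp by (simp add: w_def)
          also have "\<dots> \<le> t * pi" using tp pi_gt3 by (intro mult_left_mono) auto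
          finally show ?thesis using CR epi by simp
        qed
        moreover have "k * Im w \<ge> - R / 8"
        proof -
          have "1 \<le> L * m" using ext_m(2)[OF k] epi pi_gt3 by simp
          have "8 * \<bar>Im w0\<bar> \<le> 8 * \<bar>Im w0\<bar> * (L * m)" using \<open>1 \<le> L * m\<close> mult_left_mono[of 1 "L * m" "8 * \<bar>Im w0\<bar>"] by simp
          also have "\<dots> = \<kappa> * I * m" using kap by (simp add: I_def)
          also have "\<dots> \<le> \<kappa> * t * m" using tp kap m by (intro mult_left_mono mult_right_mono) auto
          finally have "8 * \<bar>Im w0\<bar> \<le> R" by (simp add: R_def)
          moreover have "\<bar>k * Im w\<bar> = \<bar>Im w0\<bar>" using k by (simp add: abs_mult w_def)
          ultimately show ?thesis by linarith
        qed
        ultimately show ?thesis by blast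
      qed
    qed
    ultimately show ?thesis using R C by (intro slope_if_surrounded) auto
  qed
  moreover have "eta (2 * C + 1) > 0" using C by (intro eta_pos) auto
  ultimately show ?thesis by blast
qed

end

section \<open>Non-tangential convergence in the half-plane\<close>

definition cayley :: "complex \<Rightarrow> complex \<Rightarrow> complex" where
  "cayley \<tau> z = (\<tau> + z) / (\<tau> - z)"

definition inv_cayley :: "complex \<Rightarrow> complex \<Rightarrow> complex" where
  "inv_cayley \<tau> \<zeta> = \<tau> * (\<zeta> - 1) / (\<zeta> + 1)"

lemma Re_cayley_pos:
  assumes "cmod \<tau> = 1" "z \<in> \<D>"
  shows "Re (cayley \<tau> z) > 0"
proof -
  have ne: "cmod (\<tau> - z) > 0" using assms by auto
  have "Re (cayley \<tau> z) = ((cmod \<tau>)\<^sup>2 - (cmod z)\<^sup>2) / (cmod (\<tau> - z))\<^sup>2"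
    unfolding cayley_def Re_divide cmod_power2
    by (simp add: power2_eq_square algebra_simps flip: add_divide_distrib diff_divide_distrib)
  moreover have "(cmod z)\<^sup>2 < 1" using assms by (simp add: abs_square_less_1)
  ultimately show ?thesis using ne assms(1) by simp
qed

lemma inv_cayley_in_disc:
  assumes "cmod \<tau> = 1" "Re \<zeta> > 0"
  shows "inv_cayley \<tau> \<zeta> \<in> \<D>"
proof -
  have "cmod (\<zeta> - 1) < cmod (\<zeta> + cnj 1)" by (rule cnj_sum_gt_diff) (use assms in auto)
  then show ?thesis using assms(1) by (auto simp: inv_cayley_def norm_mult norm_divide divide_less_eq)
qed

lemma inv_cayley_cayley:
  assumes "cmod \<tau> = 1" "z \<in> \<D>"
  shows "inv_cayley \<tau> (cayley \<tau> z) = z"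
proof -
  have ne: "\<tau> - z \<noteq> 0" "\<tau> \<noteq> 0" using assms by auto
  have "cayley \<tau> z - 1 = 2 * z / (\<tau> - z)" "cayley \<tau> z + 1 = 2 * \<tau> / (\<tau> - z)"
    using ne by (simp_all add: cayley_def field_simps)
  then show ?thesis using ne by (simp add: inv_cayley_def)
qed

lemma cayley_inv_cayley:
  assumes "cmod \<tau> = 1" "Re \<zeta> > 0"
  shows "cayley \<tau> (inv_cayley \<tau> \<zeta>) = \<zeta>"
proof -
  have ne: "\<zeta> + 1 \<noteq> 0" using assms(2) by (auto simp: complex_eq_iff)
  have "\<tau> \<noteq> 0" using assms(1) by auto
  have "\<tau> + inv_cayley \<tau> \<zeta> = \<zeta> * (2 * \<tau> / (\<zeta> + 1))" "\<tau> - inv_cayley \<tau> \<zeta> = 2 * \<tau> / (\<zeta> + 1)"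
    using ne by (simp_all add: inv_cayley_def field_simps)
  then show ?thesis using ne \<open>\<tau> \<noteq> 0\<close> by (simp add: cayley_def)
qed

lemma inv_cayley_holomorphic: "inv_cayley \<tau> holomorphic_on RHP"
  unfolding inv_cayley_def by (intro holomorphic_intros) (auto simp: complex_eq_iff)

lemma inj_on_inv_cayley: "cmod \<tau> = 1 \<Longrightarrow> inj_on (inv_cayley \<tau>) RHP"
  by (rule inj_on_inverseI[where g = "cayley \<tau>"]) (simp add: cayley_inv_cayley)

text \<open>In terms of \<open>\<zeta> = cayley \<tau> z\<close> one has \<open>1 - cnj \<tau> * z = 2 / (1 + \<zeta>)\<close>.\<close>

lemma angle_via_cayley:
  assumes "cmod \<tau> = 1" "z \<in> \<D>"
  shows "Arg (1 - cnj \<tau> * z) = arctan (- Im (cayley \<tau> z) / (1 + Re (cayley \<tau> z)))"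
proof -
  define \<zeta> where "\<zeta> = cayley \<tau> z"
  have pos: "Re \<zeta> > 0" using Re_cayley_pos[OF assms] by (simp add: \<zeta>_def)
  have ne: "\<tau> - z \<noteq> 0" using assms by auto
  have tau: "cnj \<tau> * \<tau> = 1" using assms(1) complex_norm_square[of \<tau>] by (simp add: mult.commute)
  have "1 - cnj \<tau> * z = cnj \<tau> * (\<tau> - z)" using tau by (simp add: algebra_simps)
  also have "\<dots> = 2 / (1 + \<zeta>)"
  proof -
    have "1 + \<zeta> = 2 * \<tau> / (\<tau> - z)" using ne by (simp add: \<zeta>_def cayley_def add_divide_eq_iff)
    then have "cnj \<tau> * (\<tau> - z) * (1 + \<zeta>) = 2 * (cnj \<tau> * \<tau>)" using ne by simp
    moreover have "1 + \<zeta> \<noteq> 0" using pos by (auto simp: complex_eq_iff)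
    ultimately show ?thesis using tau by (simp add: eq_divide_eq)
  qed
  finally have v: "1 - cnj \<tau> * z = 2 / (1 + \<zeta>)" .
  define n where "n = (cmod (1 + \<zeta>))\<^sup>2"
  have "1 + \<zeta> \<noteq> 0" using pos by (auto simp: complex_eq_iff)
  then have n: "n > 0" by (simp add: n_def)
  have "2 / (1 + \<zeta>) = of_real (2 / n) * cnj (1 + \<zeta>)"
    using complex_div_cnj[of 2 "1 + \<zeta>"] by (simp add: n_def)
  then have parts: "Re (2 / (1 + \<zeta>)) = 2 / n * (1 + Re \<zeta>)" "Im (2 / (1 + \<zeta>)) = 2 / n * (- Im \<zeta>)"
    by (simp_all del: distrib_left)
  have "Re (2 / (1 + \<zeta>)) > 0" unfolding parts using n pos by simp
  then have "Arg (2 / (1 + \<zeta>)) = arctan ((2 / n * (- Im \<zeta>)) / (2 / n * (1 + Re \<zeta>)))"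
    by (simp only: arg_conv_arctan parts)
  also have "(2 / n * (- Im \<zeta>)) / (2 / n * (1 + Re \<zeta>)) = - Im \<zeta> / (1 + Re \<zeta>)"
    by (rule mult_divide_mult_cancel_left) (use n in simp)
  finally show ?thesis unfolding v \<zeta>_def .
qed

text \<open>This form shows that cluster sets are closed.\<close>

lemma cluster_set_at_top_eq:
  fixes f :: "real \<Rightarrow> 'a::metric_space"
  shows "cluster_set_at_top f = (\<Inter>T. closure (f ` {T..}))"
proof (intro subset_antisym subsetI)
  fix a assume "a \<in> cluster_set_at_top f"
  then obtain s where s: "filterlim s at_top sequentially" "(\<lambda>n. f (s n)) \<longlonglongrightarrow> a"
    by (auto simp: cluster_set_at_top_def)
  have "a \<in> closure (f ` {T..})" for T
  proof (rule Lim_in_closed_set[OF closed_closure _ _ s(2)])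
    show "\<forall>\<^sub>F n in sequentially. f (s n) \<in> closure (f ` {T..})"
      using filterlim_at_top[THEN iffD1, OF s(1), rule_format, of T]
      by (rule eventually_mono) (intro subsetD[OF closure_subset] imageI, simp)
  qed simp
  then show "a \<in> (\<Inter>T. closure (f ` {T..}))" by blast
next
  fix a assume a: "a \<in> (\<Inter>T. closure (f ` {T..}))"
  have "\<exists>t\<ge>real n. dist (f t) a < inverse (real (Suc n))" for n
  proof -
    have "a \<in> closure (f ` {real n..})" using a by blast
    then have "\<exists>y\<in>f ` {real n..}. dist y a < inverse (real (Suc n))"
      unfolding closure_approachable by (metis inverse_positive_iff_positive of_nat_0_less_iff zero_less_Suc)
    then show ?thesis by blast
  qed
  then obtain s where s: "\<And>n. s n \<ge> real n" "\<And>n. dist (f (s n)) a < inverse (real (Suc n))" by metis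
  have "filterlim s at_top sequentially"
    using filterlim_real_sequentially by (rule filterlim_at_top_mono) (use s(1) in simp)
  moreover have "(\<lambda>n. f (s n)) \<longlonglongrightarrow> a"
  proof (rule tendsto_dist_iff[THEN iffD2], rule tendsto_sandwich[OF _ _ tendsto_const LIMSEQ_inverse_real_of_nat])
    show "\<forall>\<^sub>F n in sequentially. dist (f (s n)) a \<le> inverse (real (Suc n))"
      using less_imp_le[OF s(2)] by (intro always_eventually allI)
  qed simp
  ultimately show "a \<in> cluster_set_at_top f" by (auto simp: cluster_set_at_top_def)
qed

text \<open>If \<open>g\<close> is unbounded near infinity, then some sequence of arguments gives values of \<open>\<bar>f\<bar>\<close> tending
  to \<open>pi / 2\<close>, and by compactness \<open>pi / 2\<close> or \<open>- pi / 2\<close> is a cluster value.\<close>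

lemma arctan_cluster_set_inside_iff:
  fixes f g :: "real \<Rightarrow> real"
  assumes fg: "\<And>t. t \<ge> 0 \<Longrightarrow> f t = arctan (g t)"
  shows "compact (cluster_set_at_top f) \<and> cluster_set_at_top f \<subseteq> {- pi / 2 <..< pi / 2}
     \<longleftrightarrow> (\<exists>C T. \<forall>t\<ge>T. \<bar>g t\<bar> \<le> C)" (is "?L \<longleftrightarrow> ?R")
proof
  assume ?R
  then obtain C T where C: "\<And>t. t \<ge> T \<Longrightarrow> \<bar>g t\<bar> \<le> C" by blast
  have "f ` {max 0 T..} \<subseteq> {arctan (- C)..arctan C}"
  proof (rule image_subsetI)
    fix t :: real assume t: "t \<in> {max 0 T..}"
    then have "- C \<le> g t" "g t \<le> C" using C[of t] by (auto simp: abs_le_iff)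
    then show "f t \<in> {arctan (- C)..arctan C}" using fg[of t] t by (auto simp: arctan_le_iff simp del: arctan_minus)
  qed
  then have "closure (f ` {max 0 T..}) \<subseteq> {arctan (- C)..arctan C}"
    by (rule closure_minimal) simp
  then have sub: "cluster_set_at_top f \<subseteq> {arctan (- C)..arctan C}"
    unfolding cluster_set_at_top_eq by blast
  have "closed (cluster_set_at_top f)" unfolding cluster_set_at_top_eq by (intro closed_INT) auto
  moreover have "bounded (cluster_set_at_top f)" using sub bounded_subset bounded_closed_interval by blast
  ultimately have "compact (cluster_set_at_top f)" by (simp add: compact_eq_bounded_closed)
  moreover have "{arctan (- C)..arctan C} \<subseteq> {- pi / 2 <..< pi / 2}"
    using arctan_bounded[of C] arctan_bounded[of "- C"] by auto
  ultimately show ?L using sub by blast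
next
  assume L: ?L
  show ?R
  proof (rule ccontr)
    assume "\<not> ?R"
    then have "\<exists>t\<ge>real n. real n < \<bar>g t\<bar>" for n by (metis not_le)
    then obtain s where s: "\<And>n. s n \<ge> real n" "\<And>n. real n < \<bar>g (s n)\<bar>" by metis
    have st: "filterlim s at_top sequentially" "filterlim (\<lambda>n. \<bar>g (s n)\<bar>) at_top sequentially"
      using filterlim_real_sequentially
      by (rule filterlim_at_top_mono, use s in \<open>simp add: less_imp_le\<close>)+
    have s0: "s n \<ge> 0" for n using s(1)[of n] by linarith
    have "\<bar>f (s n)\<bar> = arctan \<bar>g (s n)\<bar>" for n
      using fg[OF s0[of n]] by (simp add: abs_if arctan_minus)
    then have lim: "(\<lambda>n. \<bar>f (s n)\<bar>) \<longlonglongrightarrow> pi / 2"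
      using filterlim_compose[OF tendsto_arctan_at_top st(2)] by simp
    have "f (s n) \<in> {- pi / 2..pi / 2}" for n
      using fg[OF s0[of n]] arctan_bounded[of "g (s n)"] by simp
    then obtain a r where r: "strict_mono (r :: nat \<Rightarrow> nat)" "((\<lambda>n. f (s n)) \<circ> r) \<longlonglongrightarrow> a"
      using compact_Icc[of "- pi / 2" "pi / 2"] unfolding compact_def by metis
    have "filterlim (s \<circ> r) at_top sequentially"
      unfolding o_def by (rule filterlim_compose[OF st(1) filterlim_subseq[OF r(1)]])
    then have "a \<in> cluster_set_at_top f"
      using r(2) by (auto simp: cluster_set_at_top_def o_def)
    then have "\<bar>a\<bar> < pi / 2" using subsetD[OF conjunct2[OF L], of a] by (auto simp: abs_less_iff)
    moreover have "\<bar>a\<bar> = pi / 2"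
    proof (rule LIMSEQ_unique)
      show "(\<lambda>n. \<bar>f (s (r n))\<bar>) \<longlonglongrightarrow> \<bar>a\<bar>" using tendsto_rabs[OF r(2)] by (simp add: o_def)
      show "(\<lambda>n. \<bar>f (s (r n))\<bar>) \<longlonglongrightarrow> pi / 2"
        using LIMSEQ_subseq_LIMSEQ[OF lim r(1)] by (simp add: o_def)
    qed
    ultimately show False by simp
  qed
qed

lemma ex_bound_eventually_cong:
  fixes P Q :: "real \<Rightarrow> real \<Rightarrow> bool"
  assumes "\<And>t C. t \<ge> 0 \<Longrightarrow> P C t \<longleftrightarrow> Q C t"
  shows "(\<exists>C T. \<forall>t\<ge>T. P C t) \<longleftrightarrow> (\<exists>C T. \<forall>t\<ge>T. Q C t)"
  by (metis assms max.bounded_iff)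

lemma nontangential_iff_cone:
  assumes "cmod \<tau> = 1" "\<And>t. t \<ge> 0 \<Longrightarrow> \<gamma> t \<in> \<D>" "(\<gamma> \<longlongrightarrow> \<tau>) at_top"
  shows "converges_non_tangentially \<gamma> \<tau> \<longleftrightarrow>
    (\<exists>C T. \<forall>t\<ge>T. \<bar>Im (cayley \<tau> (\<gamma> t))\<bar> \<le> C * (1 + Re (cayley \<tau> (\<gamma> t))))"
proof -
  define \<zeta> where "\<zeta> t = cayley \<tau> (\<gamma> t)" for t
  have "converges_non_tangentially \<gamma> \<tau> \<longleftrightarrow> (\<exists>C T. \<forall>t\<ge>T. \<bar>- Im (\<zeta> t) / (1 + Re (\<zeta> t))\<bar> \<le> C)"
    unfolding converges_non_tangentially_def Let_def using assms(3)
    by (subst arctan_cluster_set_inside_iff[where g = "\<lambda>t. - Im (\<zeta> t) / (1 + Re (\<zeta> t))"])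
       (use angle_via_cayley[OF assms(1) assms(2)] in \<open>simp_all add: \<zeta>_def\<close>)
  also have "\<dots> \<longleftrightarrow> (\<exists>C T. \<forall>t\<ge>T. \<bar>Im (\<zeta> t)\<bar> \<le> C * (1 + Re (\<zeta> t)))"
  proof -
    have eq: "\<bar>- Im (\<zeta> t) / (1 + Re (\<zeta> t))\<bar> \<le> C \<longleftrightarrow> \<bar>Im (\<zeta> t)\<bar> \<le> C * (1 + Re (\<zeta> t))" if "t \<ge> 0" for t C
      using Re_cayley_pos[OF assms(1) assms(2)[OF that]] by (simp add: \<zeta>_def abs_divide pos_divide_le_eq)
    show ?thesis by (rule ex_bound_eventually_cong[OF eq])
  qed
  finally show ?thesis by (simp add: \<zeta>_def)
qed

section \<open>Cone condition and extents\<close>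

context halfplane_koenigs
begin

text \<open>The maps \<open>z \<mapsto> F (M z + t)\<close> do not increase the hyperbolic distance, so two orbits remain
  at bounded hyperbolic distance from each other.\<close>

lemma shifts_stay_close:
  assumes "w1 \<in> N" "w2 \<in> N"
  shows "\<exists>K\<ge>0. \<forall>t\<ge>0. cmod (F (w1 + of_real t) - F (w2 + of_real t)) \<le> K * Re (F (w2 + of_real t))"
proof -
  define z1 z2 r where "z1 = F w1" and "z2 = F w2" and "r = cmod (z1 - z2) / cmod (z1 + cnj z2)"
  have z: "Re z1 > 0" "Re z2 > 0" using assms by (auto simp: z1_def z2_def)
  have lt: "cmod (z1 - z2) < cmod (z1 + cnj z2)" by (rule cnj_sum_gt_diff[OF z])
  then have nz: "cmod (z1 + cnj z2) > 0" using norm_ge_zero[of "z1 - z2"] by linarith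
  then have r: "0 \<le> r" "r < 1" using lt by (auto simp: r_def)
  have "cmod (F (w1 + of_real t) - F (w2 + of_real t)) \<le> 2 * r / (1 - r) * Re (F (w2 + of_real t))"
    if t: "t \<ge> 0" for t
  proof -
    define f where "f z = F (M z + of_real t)" for z
    have inN: "M z + of_real t \<in> N" if "Re z > 0" for z using shift_N t that by simp
    have f12: "f z1 = F (w1 + of_real t)" "f z2 = F (w2 + of_real t)"
      using assms by (simp_all add: f_def z1_def z2_def)
    have "cmod (f z1 - f z2) * cmod (z1 + cnj z2) \<le> cmod (z1 - z2) * cmod (f z1 + cnj (f z2))"
    proof (rule schwarz_pick_halfplane)
      show "f holomorphic_on RHP"
        unfolding f_def
        by (rule holomorphic_on_compose_gen[unfolded o_def, OF _ F_holo])
           (use holo inN in \<open>auto intro!: holomorphic_intros\<close>)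
      show "Re (f z) > 0" if "Re z > 0" for z using inN that by (simp add: f_def)
    qed (fact z)+
    then have "cmod (f z1 - f z2) \<le> r * cmod (f z1 + cnj (f z2))"
      using nz by (simp add: r_def field_simps)
    also have "cmod (f z1 + cnj (f z2)) \<le> cmod (f z1 - f z2) + 2 * Re (f z2)"
    proof -
      have "f z1 + cnj (f z2) = (f z1 - f z2) + of_real (2 * Re (f z2))" by (simp add: complex_eq_iff)
      moreover have "cmod (of_real (2 * Re (f z2))) = 2 * Re (f z2)"
        using Re_F_pos[OF inN[OF z(2)]] by (simp add: f_def norm_of_real del: of_real_mult)
      ultimately show ?thesis by (metis norm_triangle_ineq)
    qed
    finally have "cmod (f z1 - f z2) \<le> r * (cmod (f z1 - f z2) + 2 * Re (f z2))"
      using r by (simp add: mult_left_mono)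
    then have "cmod (f z1 - f z2) * (1 - r) \<le> 2 * r * Re (f z2)" by (simp add: algebra_simps)
    then show ?thesis using r by (simp add: f12 pos_le_divide_eq)
  qed
  moreover have "2 * r / (1 - r) \<ge> 0" using r by simp
  ultimately show ?thesis by blast
qed

text \<open>The summand \<open>1\<close> is the one in \<open>1 - cnj \<tau> * z = 2 / (1 + cayley \<tau> z)\<close>.  Along an orbit \<open>Re F\<close> is bounded
  below by a positive constant, so the condition describes a cone with apex \<open>0\<close> as well.\<close>

definition eventually_in_cone :: "complex \<Rightarrow> bool" where
  "eventually_in_cone w \<longleftrightarrow>
     (\<exists>C T. \<forall>t\<ge>T. \<bar>Im (F (w + of_real t))\<bar> \<le> C * (1 + Re (F (w + of_real t))))"

lemma eventually_in_cone_transfer: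
  assumes w: "w1 \<in> N" "w2 \<in> N" and "eventually_in_cone w1"
  shows "eventually_in_cone w2"
proof -
  obtain C T where C: "\<And>t. t \<ge> T \<Longrightarrow> \<bar>Im (F (w1 + of_real t))\<bar> \<le> C * (1 + Re (F (w1 + of_real t)))"
    using assms(3) by (auto simp: eventually_in_cone_def)
  obtain K where K: "K \<ge> 0" "\<And>t. t \<ge> 0 \<Longrightarrow> cmod (F (w1 + of_real t) - F (w2 + of_real t)) \<le> K * Re (F (w2 + of_real t))"
    using shifts_stay_close[OF w] by blast
  have "\<bar>Im (F (w2 + of_real t))\<bar> \<le> (\<bar>C\<bar> * (1 + K) + K) * (1 + Re (F (w2 + of_real t)))" if t: "t \<ge> max 0 T" for t
  proof -
    define a b where "a = F (w1 + of_real t)" and "b = F (w2 + of_real t)"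
    have ab: "cmod (a - b) \<le> K * Re b" using K t by (simp add: a_def b_def)
    have pos: "Re a > 0" "Re b > 0" using shift_N w t by (simp_all add: a_def b_def)
    have "Re a \<le> (1 + K) * Re b" using ab abs_Re_le_cmod[of "a - b"] by (simp add: algebra_simps)
    then have "1 + Re a \<le> (1 + K) * (1 + Re b)" using K(1) by (simp add: algebra_simps)
    then have "\<bar>C\<bar> * (1 + Re a) \<le> \<bar>C\<bar> * ((1 + K) * (1 + Re b))" by (intro mult_left_mono) auto
    moreover have "\<bar>Im a\<bar> \<le> \<bar>C\<bar> * (1 + Re a)"
    proof -
      have "\<bar>Im a\<bar> \<le> C * (1 + Re a)" using C[of t] t by (simp add: a_def)
      also have "\<dots> \<le> \<bar>C\<bar> * (1 + Re a)" using pos by (intro mult_right_mono) auto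
      finally show ?thesis .
    qed
    moreover have "\<bar>Im b\<bar> \<le> \<bar>Im a\<bar> + K * Re b" using ab abs_Im_le_cmod[of "a - b"] by simp
    ultimately show ?thesis using K(1) by (simp add: algebra_simps flip: a_def b_def)
  qed
  then show ?thesis unfolding eventually_in_cone_def by blast
qed

lemma eventually_in_cone_iff_slope:
  assumes N: "\<And>x. x \<ge> x0 \<Longrightarrow> of_real x \<in> N"
  shows "eventually_in_cone (of_real x0) \<longleftrightarrow>
    (\<exists>e>0. \<exists>x1\<ge>x0. \<forall>x\<ge>x1. e * cmod (q (F (of_real x))) \<le> Re (q (F (of_real x))))"
proof
  assume "eventually_in_cone (of_real x0)"
  then obtain C T where C: "\<And>t. t \<ge> T \<Longrightarrow> \<bar>Im (F (of_real x0 + of_real t))\<bar> \<le> C * (1 + Re (F (of_real x0 + of_real t)))"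
    by (auto simp: eventually_in_cone_def)
  define x1 where "x1 = x0 + max 0 T"
  define m where "m = Re (F (of_real x0))"
  have m: "m > 0" using N by (simp add: m_def)
  define C' where "C' = \<bar>C\<bar> * (1 / m + 1)"
  have cone: "\<bar>Im (F (of_real x))\<bar> \<le> C' * Re (F (of_real x))" if x: "x \<ge> x1" for x
  proof -
    have "m \<le> Re (F (of_real x))"
      using Re_F_le_shift[OF N[of x0], of "x - x0"] x by (simp add: m_def x1_def)
    then have "1 \<le> 1 / m * Re (F (of_real x))" using m by simp
    then have "\<bar>C\<bar> * (1 + Re (F (of_real x))) \<le> \<bar>C\<bar> * ((1 / m + 1) * Re (F (of_real x)))"
      by (intro mult_left_mono) (auto simp: algebra_simps)
    moreover have "\<bar>Im (F (of_real x))\<bar> \<le> C * (1 + Re (F (of_real x)))"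
      using C[of "x - x0"] x by (simp add: x1_def)
    moreover have "C * (1 + Re (F (of_real x))) \<le> \<bar>C\<bar> * (1 + Re (F (of_real x)))"
    proof (rule mult_right_mono)
      have "Re (F (of_real x)) > 0" using x by (intro Re_F_pos N) (simp add: x1_def)
      then show "0 \<le> 1 + Re (F (of_real x))" by simp
    qed simp
    ultimately show ?thesis by (simp only: mult.assoc C'_def)
  qed
  have C': "C' \<ge> 0" using m by (simp add: C'_def)
  have N1: "of_real x \<in> N" if "x \<ge> x1" for x using N[of x] that by (simp add: x1_def)
  have "\<forall>x\<ge>x1. eta (5 * C' + 6) * cmod (q (F (of_real x))) \<le> Re (q (F (of_real x)))"
    using slope_if_in_cone[OF N1 C' cone] by auto
  moreover have "eta (5 * C' + 6) > 0" using C' by (intro eta_pos) linarith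
  moreover have "x1 \<ge> x0" by (simp add: x1_def)
  ultimately show "\<exists>e>0. \<exists>x1\<ge>x0. \<forall>x\<ge>x1. e * cmod (q (F (of_real x))) \<le> Re (q (F (of_real x)))"
    by blast
next
  assume "\<exists>e>0. \<exists>x1\<ge>x0. \<forall>x\<ge>x1. e * cmod (q (F (of_real x))) \<le> Re (q (F (of_real x)))"
  then obtain e x1 where e: "e > 0" "x1 \<ge> x0"
    "\<And>x. x \<ge> x1 \<Longrightarrow> e * cmod (q (F (of_real x))) \<le> Re (q (F (of_real x)))" by blast
  have "\<exists>C\<ge>0. \<forall>x\<ge>x1. \<bar>Im (F (of_real x))\<bar> \<le> C * Re (F (of_real x))"
    by (rule cone_if_slope[OF _ e(1,3)]) (use N e(2) in auto)
  then obtain C where C: "C \<ge> 0" "\<And>x. x \<ge> x1 \<Longrightarrow> \<bar>Im (F (of_real x))\<bar> \<le> C * Re (F (of_real x))"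
    by blast
  have "\<bar>Im (F (of_real x0 + of_real t))\<bar> \<le> C * (1 + Re (F (of_real x0 + of_real t)))" if "t \<ge> x1 - x0" for t
  proof -
    have "\<bar>Im (F (of_real (x0 + t)))\<bar> \<le> C * Re (F (of_real (x0 + t)))" by (rule C(2)) (use that in simp)
    then show ?thesis using C(1) by (simp add: algebra_simps)
  qed
  then show "eventually_in_cone (of_real x0)" unfolding eventually_in_cone_def by blast
qed

lemma eventually_in_cone_iff_extents_comparable:
  assumes N: "\<And>x. x \<ge> x0 \<Longrightarrow> of_real x \<in> N"
    and c: "c > 0" "\<And>k t. \<bar>k\<bar> = 1 \<Longrightarrow> t \<ge> T \<Longrightarrow> c * extent k t \<le> extent k (t / 2)"
  shows "eventually_in_cone (of_real x0) \<longleftrightarrow>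
    (\<exists>L. \<exists>T'. \<forall>t\<ge>T'. extent 1 t \<le> L * extent (- 1) t \<and> extent (- 1) t \<le> L * extent 1 t)"
proof -
  \<comment> \<open>With the constant at most \<open>1 / 4\<close>, the half-strips lie below height \<open>t / 2\<close>, so they meet the arc of radius \<open>t / 2\<close>.\<close>
  define c' where "c' = min c (1 / 4)"
  define T1 where "T1 = max T x0"
  have pos: "extent k t > 0" if "t \<ge> x0" for k t using arc_extent_props(1)[OF open_N N[OF that]] .
  have c': "0 < c'" "c' \<le> 1 / 4" using c by (auto simp: c'_def)
  have dbl: "c' * extent k t \<le> extent k (t / 2)" if "\<bar>k\<bar> = 1" "t \<ge> T1" for k t
  proof -
    have "c' * extent k t \<le> c * extent k t" using pos[of t k] that by (intro mult_right_mono) (auto simp: c'_def T1_def)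
    then show ?thesis using c(2)[OF that(1), of t] that(2) by (simp add: T1_def)
  qed
  have "eventually_in_cone (of_real x0) \<longleftrightarrow>
    (\<exists>e>0. \<exists>x1\<ge>x0. \<forall>x\<ge>x1. e * cmod (q (F (of_real x))) \<le> Re (q (F (of_real x))))"
    by (rule eventually_in_cone_iff_slope) (rule N)
  also have "\<dots> \<longleftrightarrow>
    (\<exists>L. \<exists>T'. \<forall>t\<ge>T'. extent 1 t \<le> L * extent (- 1) t \<and> extent (- 1) t \<le> L * extent 1 t)"
  proof
    assume "\<exists>e>0. \<exists>x1\<ge>x0. \<forall>x\<ge>x1. e * cmod (q (F (of_real x))) \<le> Re (q (F (of_real x)))"
    then obtain e x1 where e: "e > 0" "x1 \<ge> x0"
      "\<And>x. x \<ge> x1 \<Longrightarrow> e * cmod (q (F (of_real x))) \<le> Re (q (F (of_real x)))" by blast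
    have N1: "of_real x \<in> N" if "x \<ge> x1" for x using N that e(2) by simp
    have comp: "\<exists>L>0. \<exists>S. \<forall>t\<ge>S. extent (- k) t \<le> L * extent k t" if "\<bar>k\<bar> = 1" for k
      by (rule extents_comparable_if_slope[of x1 e c' T1 k]; fact N1 e c' dbl that)
    obtain L1 S1 where L1: "\<And>t. t \<ge> S1 \<Longrightarrow> extent (- 1) t \<le> L1 * extent 1 t"
      using comp[of 1] by auto
    obtain L2 S2 where L2: "\<And>t. t \<ge> S2 \<Longrightarrow> extent 1 t \<le> L2 * extent (- 1) t"
      using comp[of "-1"] by auto
    have "extent 1 t \<le> max L1 L2 * extent (- 1) t \<and> extent (- 1) t \<le> max L1 L2 * extent 1 t"
      if t: "t \<ge> Max {S1, S2, x0}" for t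
    proof -
      have "L2 * extent (- 1) t \<le> max L1 L2 * extent (- 1) t" "L1 * extent 1 t \<le> max L1 L2 * extent 1 t"
        using pos[of t 1] pos[of t "-1"] t by (intro mult_right_mono; simp)+
      then show ?thesis using L1[of t] L2[of t] t by simp
    qed
    then show "\<exists>L. \<exists>T'. \<forall>t\<ge>T'. extent 1 t \<le> L * extent (- 1) t \<and> extent (- 1) t \<le> L * extent 1 t" by blast
  next
    assume "\<exists>L. \<exists>T'. \<forall>t\<ge>T'. extent 1 t \<le> L * extent (- 1) t \<and> extent (- 1) t \<le> L * extent 1 t"
    then obtain L T' where L: "\<And>t. t \<ge> T' \<Longrightarrow> extent 1 t \<le> L * extent (- 1) t \<and> extent (- 1) t \<le> L * extent 1 t"
      by blast
    define T2 where "T2 = max T' T1"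
    have dbl2: "c' * extent k t \<le> extent k (t / 2)" if "\<bar>k\<bar> = 1" "t \<ge> T2" for k t
      using dbl that by (simp add: T2_def)
    have comp: "extent k t \<le> max 1 L * extent (- k) t" if k: "\<bar>k\<bar> = 1" and t: "t \<ge> T2" for k t
    proof -
      have "k = 1 \<or> k = -1" using k by (auto simp: abs_if split: if_splits)
      then have "extent k t \<le> L * extent (- k) t" using L[of t] t by (auto simp: T2_def)
      also have "\<dots> \<le> max 1 L * extent (- k) t"
        using pos[of t "- k"] t by (intro mult_right_mono) (auto simp: T2_def T1_def)
      finally show ?thesis .
    qed
    have "\<exists>e>0. \<exists>S. \<forall>x\<ge>S. e * cmod (q (F (of_real x))) \<le> Re (q (F (of_real x)))"
      by (rule slope_if_extents_comparable[of x0 c' T2 "max 1 L"]) (fact N c' dbl2 comp max.cobounded1)+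
    then obtain e S where "e > 0" "\<And>x. x \<ge> S \<Longrightarrow> e * cmod (q (F (of_real x))) \<le> Re (q (F (of_real x)))" by blast
    then show "\<exists>e>0. \<exists>x1\<ge>x0. \<forall>x\<ge>x1. e * cmod (q (F (of_real x))) \<le> Re (q (F (of_real x)))"
      by (intro exI[of _ e] conjI exI[of _ "max S x0"]) auto
  qed
  finally show ?thesis .
qed

end

section \<open>Transfer to the disc\<close>

lemma eventually_ge_multiple_if_Liminf_pos:
  fixes f :: "real \<Rightarrow> real"
  assumes pos: "\<And>t. t \<ge> T \<Longrightarrow> f t > 0" and lim: "Liminf at_top (\<lambda>t. ereal (f (t / 2) / f t)) > 0"
  shows "\<exists>c>0. \<exists>S. \<forall>t\<ge>S. c * f t \<le> f (t / 2)"
proof -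
  obtain c where c: "0 < ereal c" "ereal c < Liminf at_top (\<lambda>t. ereal (f (t / 2) / f t))"
    using ereal_dense2[OF lim] by blast
  have "\<forall>\<^sub>F t in at_top. ereal c < ereal (f (t / 2) / f t)" by (rule less_LiminfD[OF c(2)])
  then obtain S where S: "\<And>t. t \<ge> S \<Longrightarrow> c < f (t / 2) / f t"
    by (auto simp: eventually_at_top_linorder)
  have "c * f t \<le> f (t / 2)" if "t \<ge> max S T" for t
    using S[of t] pos[of t] that by (simp add: pos_less_divide_eq less_imp_le)
  then have "\<forall>t\<ge>max S T. c * f t \<le> f (t / 2)" by blast
  moreover have "c > 0" using c(1) by simp
  ultimately show ?thesis by blast
qed

theorem proposition5p1:
  fixes \<phi> :: "real \<Rightarrow> complex \<Rightarrow> complex"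
    and \<tau> p :: complex
    and h :: "complex \<Rightarrow> complex"
    and \<Omega> :: "complex set"
  assumes "disc_semigroup \<phi>"
    and "non_elliptic \<phi>"
    and "DW_point \<phi> \<tau>"
    and "koenigs_function \<phi> h"
    and "\<Omega> = h ` \<D>"
    and "p \<in> natural_points \<Omega>"
    and "Liminf at_top (\<lambda>t. ereal (left_extent \<Omega> p (t / 2) / left_extent \<Omega> p t)) > 0"
    and "Liminf at_top (\<lambda>t. ereal (right_extent \<Omega> p (t / 2) / right_extent \<Omega> p t)) > 0"
  shows "((\<exists>z\<in>\<D>. converges_non_tangentially (\<lambda>t. \<phi> t z) \<tau>) \<longleftrightarrow>
           (\<exists>T>0. \<exists>C1 C2. 0 < C1 \<and> C1 < C2 \<and>
              (\<forall>t>T. C1 * right_extent \<Omega> p t \<le> left_extent \<Omega> p t \<and>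
                     left_extent \<Omega> p t \<le> C2 * right_extent \<Omega> p t))) \<and>
         ((\<exists>z\<in>\<D>. converges_non_tangentially (\<lambda>t. \<phi> t z) \<tau>) \<longleftrightarrow>
           (\<forall>z\<in>\<D>. converges_non_tangentially (\<lambda>t. \<phi> t z) \<tau>))"
proof -
  have tau: "cmod \<tau> = 1" and orbit: "\<And>z. z \<in> \<D> \<Longrightarrow> ((\<lambda>t. \<phi> t z) \<longlongrightarrow> \<tau>) at_top"
    using \<open>DW_point \<phi> \<tau>\<close> by (auto simp: DW_point_def)
  have disc: "\<phi> t z \<in> \<D>" if "t \<ge> 0" "z \<in> \<D>" for t z
    using \<open>disc_semigroup \<phi>\<close> that unfolding disc_semigroup_def by blast
  have h: "h holomorphic_on \<D>" "inj_on h \<D>" "\<And>t z. t \<ge> 0 \<Longrightarrow> z \<in> \<D> \<Longrightarrow> h (\<phi> t z) = h z + \<i> * of_real t"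
    using \<open>koenigs_function \<phi> h\<close> by (auto simp: koenigs_function_def)
  \<comment> \<open>The factor \<open>- \<i>\<close> turns the upward translations of \<open>\<Omega>\<close> into translations to the right.\<close>
  define M where "M \<zeta> = - \<i> * (h (inv_cayley \<tau> \<zeta>) - p)" for \<zeta>
  have inD: "inv_cayley \<tau> \<zeta> \<in> \<D>" if "Re \<zeta> > 0" for \<zeta> by (rule inv_cayley_in_disc[OF tau that])
  have M_cayley: "M (cayley \<tau> z) = - \<i> * (h z - p)" if "z \<in> \<D>" for z
    using that by (simp add: M_def inv_cayley_cayley[OF tau])
  have M_shift: "M (cayley \<tau> (\<phi> s z)) = - \<i> * (h z - p) + of_real s" if "z \<in> \<D>" "s \<ge> 0" for z s
    using that disc by (simp add: M_cayley h(3) algebra_simps)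
  have M_inj: "inj_on M RHP"
  proof (rule inj_onI)
    fix a b assume ab: "a \<in> RHP" "b \<in> RHP" "M a = M b"
    then have "h (inv_cayley \<tau> a) = h (inv_cayley \<tau> b)" by (simp add: M_def)
    then have "inv_cayley \<tau> a = inv_cayley \<tau> b"
      using inj_onD[OF h(2)] inD ab by simp
    then show "a = b" using inj_onD[OF inj_on_inv_cayley[OF tau]] ab by blast
  qed
  have inv_shift: "the_inv_into RHP M (M \<zeta> + of_real s) = cayley \<tau> (\<phi> s (inv_cayley \<tau> \<zeta>))"
    if "Re \<zeta> > 0" "s \<ge> 0" for \<zeta> s
  proof (rule the_inv_into_f_eq[OF M_inj])
    show "M (cayley \<tau> (\<phi> s (inv_cayley \<tau> \<zeta>))) = M \<zeta> + of_real s"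
      using that inD by (simp add: M_shift) (simp add: M_def)
  qed (use that inD disc Re_cayley_pos[OF tau] in simp)
  interpret halfplane_koenigs M
  proof
    show "M holomorphic_on RHP"
      unfolding M_def
      by (intro holomorphic_intros holomorphic_on_compose_gen[unfolded o_def, OF inv_cayley_holomorphic h(1)])
         (use inD in auto)
    show "inj_on M RHP" by (rule M_inj)
    fix z :: complex assume z: "Re z > 0"
    show "M z + of_real s \<in> M ` RHP" if "s \<ge> 0" for s
    proof (rule image_eqI)
      show "M z + of_real s = M (cayley \<tau> (\<phi> s (inv_cayley \<tau> z)))"
        using that z inD by (simp add: M_shift) (simp add: M_def)
    qed (use that z inD disc Re_cayley_pos[OF tau] in simp)
    have lim: "((\<lambda>s. \<phi> s (inv_cayley \<tau> z)) \<longlongrightarrow> \<tau>) at_top" by (rule orbit[OF inD[OF z]])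
    have "filterlim (\<lambda>s. cayley \<tau> (\<phi> s (inv_cayley \<tau> z))) at_infinity at_top"
      unfolding cayley_def divide_inverse
    proof (rule tendsto_mult_filterlim_at_infinity[OF _ _ filterlim_compose[OF filterlim_inverse_at_infinity]])
      show "((\<lambda>s. \<tau> + \<phi> s (inv_cayley \<tau> z)) \<longlongrightarrow> \<tau> + \<tau>) at_top" by (intro tendsto_intros lim)
      show "filterlim (\<lambda>s. \<tau> - \<phi> s (inv_cayley \<tau> z)) (at 0) at_top"
        unfolding filterlim_at
      proof
        show "\<forall>\<^sub>F s in at_top. \<tau> - \<phi> s (inv_cayley \<tau> z) \<in> UNIV \<and> \<tau> - \<phi> s (inv_cayley \<tau> z) \<noteq> 0"
          using eventually_ge_at_top[of 0]
        proof eventually_elim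
          case (elim s)
          have "cmod (\<phi> s (inv_cayley \<tau> z)) < 1" using disc[OF elim inD[OF z]] by simp
          then show ?case using tau by auto
        qed
        show "((\<lambda>s. \<tau> - \<phi> s (inv_cayley \<tau> z)) \<longlongrightarrow> 0) at_top"
          using tendsto_diff[OF tendsto_const lim, of \<tau>] by simp
      qed
      show "\<tau> + \<tau> \<noteq> 0" using tau by auto
    qed
    then show "filterlim (\<lambda>s. the_inv_into RHP M (M z + of_real s)) at_infinity at_top"
      by (rule filterlim_mono_eventually[OF _ order_refl order_refl])
         (use eventually_ge_at_top[of 0] in eventually_elim, simp add: inv_shift z)
  qed
  have N_iff: "w \<in> N \<longleftrightarrow> p + \<i> * w \<in> \<Omega>" for w
  proof
    assume "w \<in> N"
    then obtain \<zeta> where "Re \<zeta> > 0" "w = M \<zeta>" by (auto simp: N_def)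
    then have "p + \<i> * w = h (inv_cayley \<tau> \<zeta>)" by (simp add: M_def)
    then show "p + \<i> * w \<in> \<Omega>" using inD[OF \<open>Re \<zeta> > 0\<close>] \<open>\<Omega> = h ` \<D>\<close> by simp
  next
    assume "p + \<i> * w \<in> \<Omega>"
    then obtain z where z: "z \<in> \<D>" "p + \<i> * w = h z" using \<open>\<Omega> = h ` \<D>\<close> by blast
    then have "h z - p = \<i> * w" by (simp add: algebra_simps)
    then have "M (cayley \<tau> z) = w" by (simp add: M_cayley[OF z(1)])
    then show "w \<in> N" using M_in_N[OF Re_cayley_pos[OF tau z(1)]] by simp
  qed
  have left: "left_extent \<Omega> p t = extent 1 t" and right: "right_extent \<Omega> p t = extent (- 1) t" for t
    unfolding left_extent_def right_extent_def arc_extent_def N_iff cis_conv_exp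
    by (simp_all add: mult.assoc)
  obtain t0 where t0: "t0 \<ge> 0" "\<And>t. t > t0 \<Longrightarrow> p + \<i> * of_real t \<in> \<Omega>"
    using \<open>p \<in> natural_points \<Omega>\<close> by (auto simp: natural_points_def)
  define x0 where "x0 = t0 + 1"
  have N: "of_real x \<in> N" if "x \<ge> x0" for x using t0(2)[of x] that by (simp add: N_iff x0_def)
  have pos: "extent k t > 0" if "t \<ge> x0" for k t using arc_extent_props(1)[OF open_N N[OF that]] .
  obtain c1 S1 where c1: "c1 > 0" "\<And>t. t \<ge> S1 \<Longrightarrow> c1 * extent 1 t \<le> extent 1 (t / 2)"
    using eventually_ge_multiple_if_Liminf_pos[of x0 "extent 1"] pos assms(7) unfolding left by blast
  obtain c2 S2 where c2: "c2 > 0" "\<And>t. t \<ge> S2 \<Longrightarrow> c2 * extent (- 1) t \<le> extent (- 1) (t / 2)"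
    using eventually_ge_multiple_if_Liminf_pos[of x0 "extent (- 1)"] pos assms(8) unfolding right by blast
  have dbl: "min c1 c2 * extent k t \<le> extent k (t / 2)" if k: "\<bar>k\<bar> = 1" and t: "t \<ge> Max {S1, S2, x0}" for k t
  proof -
    have "min c1 c2 * extent k t \<le> c1 * extent k t" "min c1 c2 * extent k t \<le> c2 * extent k t"
      using pos[of t k] t by (intro mult_right_mono; simp)+
    moreover have "k = 1 \<or> k = - 1" using k by (auto simp: abs_if split: if_splits)
    ultimately show ?thesis using c1(2)[of t] c2(2)[of t] t by auto
  qed
  have trajectory: "converges_non_tangentially (\<lambda>t. \<phi> t z) \<tau> \<longleftrightarrow> eventually_in_cone (of_real x0)" if z: "z \<in> \<D>" for z
  proof -
    define w where "w = - \<i> * (h z - p)"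
    have w: "w \<in> N" using M_in_N[OF Re_cayley_pos[OF tau z]] by (simp add: w_def M_cayley[OF z])
    have F: "F (w + of_real t) = cayley \<tau> (\<phi> t z)" if "t \<ge> 0" for t
      using M_shift[OF z that] F_M[OF Re_cayley_pos[OF tau disc[OF that z]]] by (simp add: w_def)
    have "converges_non_tangentially (\<lambda>t. \<phi> t z) \<tau> \<longleftrightarrow>
      (\<exists>C T. \<forall>t\<ge>T. \<bar>Im (cayley \<tau> (\<phi> t z))\<bar> \<le> C * (1 + Re (cayley \<tau> (\<phi> t z))))"
      using disc z orbit by (intro nontangential_iff_cone tau) auto
    also have "\<dots> \<longleftrightarrow> eventually_in_cone w"
      unfolding eventually_in_cone_def by (rule ex_bound_eventually_cong) (simp add: F)
    also have "\<dots> \<longleftrightarrow> eventually_in_cone (of_real x0)"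
      using eventually_in_cone_transfer w N[of x0] by blast
    finally show ?thesis .
  qed
  have "eventually_in_cone (of_real x0) \<longleftrightarrow>
    (\<exists>L. \<exists>T'. \<forall>t\<ge>T'. extent 1 t \<le> L * extent (- 1) t \<and> extent (- 1) t \<le> L * extent 1 t)"
  proof (rule eventually_in_cone_iff_extents_comparable)
    show "min c1 c2 > 0" using c1(1) c2(1) by simp
  qed (fact N dbl)+
  also have "\<dots> \<longleftrightarrow> (\<exists>T>0. \<exists>C1 C2. 0 < C1 \<and> C1 < C2 \<and>
     (\<forall>t>T. C1 * extent (- 1) t \<le> extent 1 t \<and> extent 1 t \<le> C2 * extent (- 1) t))" (is "?A \<longleftrightarrow> ?B")
  proof
    assume ?A
    then obtain L T' where L: "\<And>t. t \<ge> T' \<Longrightarrow> extent 1 t \<le> L * extent (- 1) t \<and> extent (- 1) t \<le> L * extent 1 t" by blast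
    define C where "C = max L 1 + 1"
    have C: "C > 1" "C \<ge> L" by (auto simp: C_def)
    have "1 / C * extent (- 1) t \<le> extent 1 t \<and> extent 1 t \<le> C * extent (- 1) t" if t: "t > max T' x0" for t
    proof -
      have "L * extent (- 1) t \<le> C * extent (- 1) t" "L * extent 1 t \<le> C * extent 1 t"
        using C pos[of t 1] pos[of t "- 1"] t by (intro mult_right_mono; simp)+
      then have "extent 1 t \<le> C * extent (- 1) t" "extent (- 1) t \<le> C * extent 1 t" using L[of t] t by auto
      then show ?thesis using C(1) by (simp add: pos_divide_le_eq mult.commute)
    qed
    moreover have "0 < 1 / C" "1 / C < C" using C(1) by (auto simp: divide_less_eq intro: less_trans less_1_mult)
    moreover have "max T' x0 > 0" using t0(1) by (simp add: x0_def)
    ultimately show ?B by (intro exI[of _ "max T' x0"] exI[of _ "1 / C"] exI[of _ C] conjI) auto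
  next
    assume ?B
    then obtain T C1 C2 where C: "0 < C1" "C1 < C2"
      "\<And>t. t > T \<Longrightarrow> C1 * extent (- 1) t \<le> extent 1 t \<and> extent 1 t \<le> C2 * extent (- 1) t" by blast
    have "extent 1 t \<le> max C2 (1 / C1) * extent (- 1) t \<and> extent (- 1) t \<le> max C2 (1 / C1) * extent 1 t"
      if t: "t \<ge> max (T + 1) x0" for t
    proof -
      have "C2 * extent (- 1) t \<le> max C2 (1 / C1) * extent (- 1) t" "1 / C1 * extent 1 t \<le> max C2 (1 / C1) * extent 1 t"
        using pos[of t 1] pos[of t "- 1"] t by (intro mult_right_mono; simp)+
      moreover have "extent (- 1) t \<le> 1 / C1 * extent 1 t" using C(1) C(3)[of t] t by (simp add: pos_le_divide_eq mult.commute)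
      ultimately show ?thesis using C(3)[of t] t by simp
    qed
    then show ?A by blast
  qed
  finally have comp: "eventually_in_cone (of_real x0) \<longleftrightarrow> ?B" .
  have "(0::complex) \<in> \<D>" by simp
  then have "(\<exists>z\<in>\<D>. converges_non_tangentially (\<lambda>t. \<phi> t z) \<tau>) \<longleftrightarrow> eventually_in_cone (of_real x0)"
    "(\<forall>z\<in>\<D>. converges_non_tangentially (\<lambda>t. \<phi> t z) \<tau>) \<longleftrightarrow> eventually_in_cone (of_real x0)"
    using trajectory by blast+
  with comp show ?thesis unfolding left right by simp
qed

end
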